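(* Let $\mu$ be a probability measure on Thompson's group $F$ with a finite first moment, the support of which generates $F$ as a semigroup. Then the induced random walk on the set $D=\mathbb{Z}[\frac12]\cap(0,1)$ of dyadic rationals has non-trivial Poisson boundary.
   Context: The set of dyadic rationals $\mathbb{Z}[\frac12]$ is the set of numbers of the form $a2^b$ with $a,b\in\mathbb{Z}$. Thompson's group $F$ is the group of orientation-preserving piecewise linear self-isomorphisms of the closed unit interval $[0,1]$ with dyadic slopes (slopes that are integer powers of $2$), with a finite number of break points, all break points being in $\mathbb{Z}[\frac12]$. It is finitely generated and acts transitively on $D=\mathbb{Z}[\frac12]\cap(0,1)$; the action is written on the right, $x.g=g(x)$, the product in $F$ being such that $x.(gh)=(x.g).h$. First moment: the first moment of $\mu$ is $\sum_{g\in F}|g|\,\mu(g)$, where $|g|$ is the word length of $g$ with respect to a finite generating set. Induced random walk: let $(h_n)$ be i.i.d. with law $\mu$, let $g_0=e$ and $g_{n+1}=g_nh_n$. For a starting point $\mathfrak{o}\in D$ the induced random walk is $(\mathfrak{o}.g_n)_n$; it is the Markov chain on $D$ with kernel $P(x,y)=\sum_{g\in F:\,x.g=y}\mu(g)$. The Poisson boundary of this (irreducible) Markov chain is non-trivial if and only if there is a non-constant bounded function $f:D\to\mathbb{R}$ that is $P$-harmonic, i.e. $f(x)=\sum_{y}P(x,y)f(y)$ for all $x\in D$. *)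

theory Defs
  imports "HOL-Probability.Probability" "HOL-Algebra.Generated_Groups"
begin

definition dyadic_rationals :: "real set" where
  "dyadic_rationals = {of_int a * 2 powi b | (a::int) (b::int). True}"

definition dyadic_points :: "real set" where
  "dyadic_points = dyadic_rationals \<inter> {0<..<1}"

(* A self-map of [0,1] is represented by its extension to the reals by the identity.
   The finite set B contains the break points: f is affine, with slope a power of 2,
   on each closed interval with no point of B in its interior. *)
definition thompson_maps :: "(real \<Rightarrow> real) set" where
  "thompson_maps = {f.
     (\<forall>x. x \<notin> {0..1} \<longrightarrow> f x = x) \<and>
     bij_betw f {0..1} {0..1} \<and>
     strict_mono_on {0..1} f \<and>
     (\<exists>B. finite B \<and> B \<subseteq> dyadic_rationals \<and>
        (\<forall>a b. 0 \<le> a \<and> a < b \<and> b \<le> 1 \<and> {a<..<b} \<inter> B = {} \<longrightarrow>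
           (\<exists>(k::int) (c::real). \<forall>x\<in>{a..b}. f x = 2 powi k * x + c)))}"

(* The group acts on the right, x.(gh) = (x.g).h, so g is applied first in the product g h. *)
definition thompson_F :: "(real \<Rightarrow> real) monoid" where
  "thompson_F = \<lparr>carrier = thompson_maps, mult = (\<lambda>g h. h \<circ> g), one = id\<rparr>"

inductive_set semigroup_generate :: "('a, 'b) monoid_scheme \<Rightarrow> 'a set \<Rightarrow> 'a set"
  for G and A where
    incl: "a \<in> A \<Longrightarrow> a \<in> semigroup_generate G A"
  | mult: "a \<in> semigroup_generate G A \<Longrightarrow> b \<in> semigroup_generate G A
            \<Longrightarrow> a \<otimes>\<^bsub>G\<^esub> b \<in> semigroup_generate G A"

definition finite_generating_set :: "('a, 'b) monoid_scheme \<Rightarrow> 'a set \<Rightarrow> bool" where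
  "finite_generating_set G S \<longleftrightarrow> finite S \<and> S \<subseteq> carrier G \<and> generate G S = carrier G"

definition word_length :: "('a, 'b) monoid_scheme \<Rightarrow> 'a set \<Rightarrow> 'a \<Rightarrow> nat" where
  "word_length G S g =
     (LEAST n. \<exists>ws. length ws = n \<and> set ws \<subseteq> S \<union> m_inv G ` S \<and>
                    foldr (mult G) ws \<one>\<^bsub>G\<^esub> = g)"

definition finite_first_moment :: "('a, 'b) monoid_scheme \<Rightarrow> 'a set \<Rightarrow> 'a pmf \<Rightarrow> bool" where
  "finite_first_moment G S \<mu> \<longleftrightarrow>
     (\<lambda>g. real (word_length G S g) * pmf \<mu> g) summable_on carrier G"

(* Transition kernel of the chain (o.g_n), where g_{n+1} = g_n h_n with h_n i.i.d. of law \<mu>;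
   the image x.g is g x. *)
definition induced_walk_kernel :: "(real \<Rightarrow> real) pmf \<Rightarrow> real \<Rightarrow> real \<Rightarrow> real" where
  "induced_walk_kernel \<mu> x y = (\<Sum>\<^sub>\<infinity>g\<in>{g \<in> carrier thompson_F. g x = y}. pmf \<mu> g)"

definition harmonic_on :: "'a set \<Rightarrow> ('a \<Rightarrow> 'a \<Rightarrow> real) \<Rightarrow> ('a \<Rightarrow> real) \<Rightarrow> bool" where
  "harmonic_on X P f \<longleftrightarrow> (\<forall>x\<in>X. f x = (\<Sum>\<^sub>\<infinity>y\<in>X. P x y * f y))"

(* For an irreducible Markov kernel P on the countable set X: the Poisson boundary represents
   the bounded P-harmonic functions, so it is non-trivial iff one of them is non-constant.
   By irreducibility this does not depend on a starting point. *)
definition nontrivial_poisson_boundary :: "'a set \<Rightarrow> ('a \<Rightarrow> 'a \<Rightarrow> real) \<Rightarrow> bool" where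
  "nontrivial_poisson_boundary X P \<longleftrightarrow>
     (\<exists>f. bounded (f ` X) \<and> harmonic_on X P f \<and> \<not> f constant_on X)"

end

theory Submission
  imports Defs "HOL-Complex_Analysis.Great_Picard"
begin

text \<open>
  Write \<open>P f x\<close> for the expectation of \<open>f (g x)\<close>, with \<open>g\<close> of law \<open>\<mu>\<close>.  Call a set \<open>A\<close> of
  dyadic points almost invariant if every \<open>g\<close> changes the membership in \<open>A\<close> of only finitely many
  points.  A finite first moment then makes \<open>P 1\<^sub>A - 1\<^sub>A\<close> summable, because the number of points
  that change sides is subadditive under products and hence at most linear in the word length.
  In probabilistic terms, if the walk is transient it changes sides finitely often, and the
  probability that it ends up in \<open>A\<close> is harmonic.  The argument below obtains such a function
  as a limit of averages, controlled by an energy estimate.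

  Let \<open>f\<^sub>N\<close> be the average of \<open>1\<^sub>A, P 1\<^sub>A, \<dots>, P\<^sup>N\<^sup>-\<^sup>1 1\<^sub>A\<close> and \<open>u = f\<^sub>N - 1\<^sub>A\<close>.  Then \<open>u\<close> is summable and
  bounded by \<open>1\<close>, and its energy \<open>\<Sum>x. u x * (u x - P u x)\<close> is bounded by twice the
  \<open>\<ell>\<^sup>1\<close>-norm of \<open>P 1\<^sub>A - 1\<^sub>A\<close>, uniformly in \<open>N\<close> (lemma \<open>cesaro_energy\<close>).  Since each \<open>g\<close> permutes the
  points, the energy is half the mean of \<open>\<Sum>x. (u x - u (g x))\<^sup>2\<close>, whether or not \<open>\<mu>\<close> is symmetric.
  Hence it controls this sum for every \<open>g\<close> in the support, and by the triangle inequality for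
  every \<open>g\<close> in the semigroup generated by the support, that is, for every element of the group.

  Non-amenability enters through two elements \<open>a, b\<close> that map a set \<open>T\<close> of points into disjoint
  subsets of \<open>T\<close>.  If \<open>u\<close> were almost invariant under both in \<open>\<ell>\<^sup>2\<close>, each of the two images
  would carry almost the full \<open>\<ell>\<^sup>2\<close>-mass of \<open>u\<close> on \<open>T\<close>; so this mass is bounded by the energy
  (lemma \<open>sum_branching_le\<close>).  A pointwise limit \<open>f\<close> of a subsequence of \<open>f\<^sub>N\<close> is therefore harmonic with
  \<open>f - 1\<^sub>A\<close> square summable on \<open>T\<close>.  If both \<open>T \<inter> A\<close> and \<open>T - A\<close> are infinite, \<open>f\<close> comes close to \<open>1\<close>
  on the first and close to \<open>0\<close> on the second, so it is not constant (theorem \<open>nonconstant_harmonic\<close>).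

  For Thompson's group, \<open>A\<close> consists of the points \<open>q / 2\<^sup>n\<close> with \<open>q\<close> congruent to \<open>1\<close> modulo \<open>4\<close>.  A piece
  \<open>x \<mapsto> 2\<^sup>k x + c\<close> with dyadic \<open>c\<close> changes an odd numerator only by a multiple of \<open>4\<close> as soon as the
  denominator of \<open>x\<close> is large, and only finitely many points have a small denominator.  The
  set \<open>T\<close> is the interval \<open>[1/4, 3/4)\<close>, which two elements of the group halve onto \<open>[1/4, 1/2)\<close> and
  onto \<open>[1/2, 3/4)\<close>.
\<close>

section \<open>Random walks driven by permutations of a countable set\<close>

definition moved_points :: "'a set \<Rightarrow> 'a set \<Rightarrow> ('a \<Rightarrow> 'a) \<Rightarrow> 'a set" where
  "moved_points X A g = {x \<in> X. (g x \<in> A) \<noteq> (x \<in> A)}"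

text \<open>
  A point moved across the boundary of \<open>A\<close> by \<open>h \<circ> g\<close> is moved by \<open>g\<close>, or its image under \<open>g\<close> is
  moved by \<open>h\<close>; injectivity of \<open>g\<close> bounds the number of points of the second kind.
\<close>
lemma moved_points_comp:
  assumes g: "bij_betw g X X" and fin: "finite (moved_points X A g)" "finite (moved_points X A h)"
  shows "finite (moved_points X A (h \<circ> g))"
    and "card (moved_points X A (h \<circ> g)) \<le> card (moved_points X A g) + card (moved_points X A h)"
proof -
  let ?V = "{x \<in> X. g x \<in> moved_points X A h}"
  have inj: "inj_on g ?V" using g by (auto simp: bij_betw_def inj_on_def)
  have im: "g ` ?V \<subseteq> moved_points X A h" by auto
  have V: "finite ?V" by (rule inj_on_finite[OF inj im fin(2)])
  have cV: "card ?V \<le> card (moved_points X A h)" by (rule card_inj_on_le[OF inj im fin(2)])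
  have sub: "moved_points X A (h \<circ> g) \<subseteq> moved_points X A g \<union> ?V"
    using g by (auto simp: moved_points_def bij_betw_def)
  show "finite (moved_points X A (h \<circ> g))" by (rule finite_subset[OF sub]) (use fin V in simp)
  have "card (moved_points X A (h \<circ> g)) \<le> card (moved_points X A g \<union> ?V)"
    by (rule card_mono[OF _ sub]) (use fin V in simp)
  also have "\<dots> \<le> card (moved_points X A g) + card ?V" by (rule card_Un_le)
  finally show "card (moved_points X A (h \<circ> g)) \<le> card (moved_points X A g) + card (moved_points X A h)"
    using cV by simp
qed

locale permutation_walk =
  fixes X :: "'a set" and \<mu> :: "('a \<Rightarrow> 'a) pmf"
  assumes countable_X: "countable X"
    and perm: "g \<in> set_pmf \<mu> \<Longrightarrow> bij_betw g X X"
begin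

definition markov :: "('a \<Rightarrow> real) \<Rightarrow> 'a \<Rightarrow> real" where
  "markov f x = measure_pmf.expectation \<mu> (\<lambda>g. f (g x))"

abbreviation summable_X :: "('a \<Rightarrow> real) \<Rightarrow> bool" where
  "summable_X \<equiv> integrable (count_space X)"

abbreviation sum_X :: "('a \<Rightarrow> real) \<Rightarrow> real" where
  "sum_X \<equiv> integral\<^sup>L (count_space X)"

lemma perm_in: "g \<in> set_pmf \<mu> \<Longrightarrow> x \<in> X \<Longrightarrow> g x \<in> X"
  using perm by (auto simp: bij_betw_def)

text \<open>
  Fubini's theorem for the product of \<open>\<mu>\<close> and the counting measure on \<open>X\<close>.
\<close>
lemma sum_swap:
  fixes h :: "('a \<Rightarrow> 'a) \<Rightarrow> 'a \<Rightarrow> real"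
  assumes h: "\<And>g. g \<in> set_pmf \<mu> \<Longrightarrow> summable_X (h g)"
    and hh: "integrable (measure_pmf \<mu>) (\<lambda>g. sum_X (\<lambda>x. \<bar>h g x\<bar>))"
  shows summable_expectation: "summable_X (\<lambda>x. measure_pmf.expectation \<mu> (\<lambda>g. h g x))"
    and sum_expectation: "sum_X (\<lambda>x. measure_pmf.expectation \<mu> (\<lambda>g. h g x))
           = measure_pmf.expectation \<mu> (\<lambda>g. sum_X (h g))"
    and integrable_sum: "integrable (measure_pmf \<mu>) (\<lambda>g. sum_X (h g))"
proof -
  interpret pair_sigma_finite "measure_pmf \<mu>" "count_space X"
    by (intro pair_sigma_finite.intro sigma_finite_measure_count_space_countable countable_X)
       unfold_locales
  have m: "case_prod h \<in> borel_measurable (measure_pmf \<mu> \<Otimes>\<^sub>M count_space X)"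
  proof -
    have "(\<lambda>p. (\<lambda>x p. h (fst p) x) (snd p) p) \<in> borel_measurable (measure_pmf \<mu> \<Otimes>\<^sub>M count_space X)"
    proof (rule measurable_compose_countable'[where I = X])
      fix x
      have "(\<lambda>g. h g x) \<in> borel_measurable (measure_pmf \<mu>)" by simp
      from measurable_compose[OF measurable_fst this]
      show "(\<lambda>p. h (fst p) x) \<in> borel_measurable (measure_pmf \<mu> \<Otimes>\<^sub>M count_space X)" .
    qed (use countable_X measurable_snd in simp_all)
    then show ?thesis by (simp add: case_prod_unfold)
  qed
  have i: "integrable (measure_pmf \<mu> \<Otimes>\<^sub>M count_space X) (case_prod h)"
  proof (rule Fubini_integrable[OF m])
    show "integrable (measure_pmf \<mu>) (\<lambda>g. \<integral>x. norm (case (g, x) of (g, x) \<Rightarrow> h g x) \<partial>count_space X)"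
      using hh by simp
    show "AE g in measure_pmf \<mu>. summable_X (\<lambda>x. case (g, x) of (g, x) \<Rightarrow> h g x)"
      unfolding AE_measure_pmf_iff using h by simp
  qed
  show "summable_X (\<lambda>x. measure_pmf.expectation \<mu> (\<lambda>g. h g x))"
    by (rule integrable_snd[OF i])
  show "sum_X (\<lambda>x. measure_pmf.expectation \<mu> (\<lambda>g. h g x))
           = measure_pmf.expectation \<mu> (\<lambda>g. sum_X (h g))"
    using integral_snd[OF i] integral_fst[OF i] by simp
  show "integrable (measure_pmf \<mu>) (\<lambda>g. sum_X (h g))"
    by (rule integrable_fst[OF i])
qed

lemma sum_abs_expectation_le:
  fixes h :: "('a \<Rightarrow> 'a) \<Rightarrow> 'a \<Rightarrow> real"
  assumes h: "\<And>g. g \<in> set_pmf \<mu> \<Longrightarrow> summable_X (h g)"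
    and hh: "integrable (measure_pmf \<mu>) (\<lambda>g. sum_X (\<lambda>x. \<bar>h g x\<bar>))"
  shows "sum_X (\<lambda>x. \<bar>measure_pmf.expectation \<mu> (\<lambda>g. h g x)\<bar>)
           \<le> measure_pmf.expectation \<mu> (\<lambda>g. sum_X (\<lambda>x. \<bar>h g x\<bar>))"
proof -
  have "sum_X (\<lambda>x. \<bar>measure_pmf.expectation \<mu> (\<lambda>g. h g x)\<bar>)
     \<le> sum_X (\<lambda>x. measure_pmf.expectation \<mu> (\<lambda>g. \<bar>h g x\<bar>))"
  proof (rule integral_mono)
    show "summable_X (\<lambda>x. \<bar>measure_pmf.expectation \<mu> (\<lambda>g. h g x)\<bar>)"
      by (rule integrable_abs[OF summable_expectation[OF h hh]])
    show "summable_X (\<lambda>x. measure_pmf.expectation \<mu> (\<lambda>g. \<bar>h g x\<bar>))"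
      by (rule summable_expectation) (use h hh in auto)
    show "\<bar>measure_pmf.expectation \<mu> (\<lambda>g. h g x)\<bar> \<le> measure_pmf.expectation \<mu> (\<lambda>g. \<bar>h g x\<bar>)" for x
      by (rule integral_abs_bound)
  qed
  also have "\<dots> = measure_pmf.expectation \<mu> (\<lambda>g. sum_X (\<lambda>x. \<bar>h g x\<bar>))"
    by (rule sum_expectation) (use h hh in auto)
  finally show ?thesis .
qed

lemma summable_perm: "bij_betw g X X \<Longrightarrow> summable_X (\<lambda>x. u (g x)) \<longleftrightarrow> summable_X u"
  by (rule integrable_bij_count_space)

lemma sum_perm: "bij_betw g X X \<Longrightarrow> sum_X (\<lambda>x. u (g x)) = sum_X u" for u :: "'a \<Rightarrow> real"
  by (rule integral_bij_count_space)

lemma integrable_pmf_bounded: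
  assumes "\<And>g. g \<in> set_pmf \<mu> \<Longrightarrow> \<bar>F g\<bar> \<le> (B::real)"
  shows "integrable (measure_pmf \<mu>) F"
  by (rule measure_pmf.integrable_const_bound[where B = B]) (use assms in \<open>auto simp: AE_measure_pmf_iff\<close>)

text \<open>
  The walk contracts \<open>\<ell>\<^sup>1\<close>: counting measure is stationary, because every step is a permutation.
\<close>
lemma markov_summable:
  assumes "summable_X u"
  shows "summable_X (markov u)" and "sum_X (\<lambda>x. \<bar>markov u x\<bar>) \<le> sum_X (\<lambda>x. \<bar>u x\<bar>)"
proof -
  have 1: "summable_X (\<lambda>x. u (g x))" if "g \<in> set_pmf \<mu>" for g
    using that assms by (simp add: summable_perm perm)
  have 2: "sum_X (\<lambda>x. \<bar>u (g x)\<bar>) = sum_X (\<lambda>x. \<bar>u x\<bar>)" if "g \<in> set_pmf \<mu>" for g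
    using sum_perm[OF perm[OF that], of "\<lambda>x. \<bar>u x\<bar>"] .
  have 3: "integrable (measure_pmf \<mu>) (\<lambda>g. sum_X (\<lambda>x. \<bar>u (g x)\<bar>))"
    by (rule integrable_pmf_bounded[where B="sum_X (\<lambda>x. \<bar>u x\<bar>)"]) (simp add: 2)
  show "summable_X (markov u)"
    unfolding markov_def[abs_def] by (rule summable_expectation) (use 1 3 in auto)
  have "sum_X (\<lambda>x. \<bar>markov u x\<bar>) \<le> measure_pmf.expectation \<mu> (\<lambda>g. sum_X (\<lambda>x. \<bar>u (g x)\<bar>))"
    unfolding markov_def[abs_def] by (rule sum_abs_expectation_le) (use 1 3 in auto)
  also have "\<dots> = measure_pmf.expectation \<mu> (\<lambda>g. sum_X (\<lambda>x. \<bar>u x\<bar>))"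
    by (rule integral_cong_AE) (auto simp: AE_measure_pmf_iff 2)
  finally show "sum_X (\<lambda>x. \<bar>markov u x\<bar>) \<le> sum_X (\<lambda>x. \<bar>u x\<bar>)" by simp
qed

definition variation :: "('a \<Rightarrow> 'a) \<Rightarrow> ('a \<Rightarrow> real) \<Rightarrow> real" where
  "variation g u = sum_X (\<lambda>x. (u x - u (g x))\<^sup>2)"

text \<open>
  The Dirichlet form of the kernel; antisymmetric parts of the kernel do not contribute to it.
\<close>
definition energy :: "('a \<Rightarrow> real) \<Rightarrow> real" where
  "energy u = sum_X (\<lambda>x. u x * (u x - markov u x))"

text \<open>
  Such functions are square summable, and all double sums below converge absolutely.
\<close>
definition test_function :: "('a \<Rightarrow> real) \<Rightarrow> bool" where
  "test_function u \<longleftrightarrow> summable_X u \<and> (\<forall>x\<in>X. \<bar>u x\<bar> \<le> 1)"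

lemma summable_X_mult_bounded:
  assumes "summable_X u" "\<And>x. x \<in> X \<Longrightarrow> \<bar>v x\<bar> \<le> B"
  shows "summable_X (\<lambda>x. u x * v x)"
proof (rule Bochner_Integration.integrable_bound)
  show "summable_X (\<lambda>x. u x * B)" using assms by simp
  show "AE x in count_space X. norm (u x * v x) \<le> norm (u x * B)"
  proof (rule AE_I2)
    fix x assume "x \<in> space (count_space X)"
    then have "\<bar>v x\<bar> \<le> \<bar>B\<bar>" using assms(2)[of x] by simp
    then show "norm (u x * v x) \<le> norm (u x * B)" by (simp add: abs_mult mult_left_mono)
  qed
qed simp

lemma test_function_product:
  assumes "test_function u" "bij_betw g X X" "bij_betw h X X"
  shows "summable_X (\<lambda>x. u (g x) * u (h x))"
proof (rule summable_X_mult_bounded[where B=1])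
  show "summable_X (\<lambda>x. u (g x))" using assms by (simp add: summable_perm test_function_def)
  show "\<bar>u (h x)\<bar> \<le> 1" if "x \<in> X" for x
    using assms that by (auto simp: test_function_def bij_betw_def)
qed

lemma test_function_square:
  assumes "test_function u" "bij_betw g X X" "bij_betw h X X"
  shows "summable_X (\<lambda>x. (u (g x) - u (h x))\<^sup>2)"
proof -
  note p = test_function_product[OF assms(1)]
  have "(\<lambda>x. (u (g x) - u (h x))\<^sup>2) = (\<lambda>x. u (g x) * u (g x) + u (h x) * u (h x) - 2 * (u (g x) * u (h x)))"
    by (auto simp: power2_eq_square algebra_simps)
  then show ?thesis
    using p[OF assms(2,2)] p[OF assms(3,3)] p[OF assms(2,3)] by simp
qed

lemma bij_id: "bij_betw (\<lambda>x. x) X X"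
  using bij_betw_id[of X] by (simp add: id_def)

text \<open>
  Since \<open>g\<close> preserves counting measure, \<open>u\<close> and \<open>u \<circ> g\<close> have the same \<open>\<ell>\<^sup>2\<close>-norm, and half the
  squared distance between them is that norm squared minus the inner product.
\<close>
lemma variation_expand:
  assumes "test_function u" "bij_betw g X X"
  shows "sum_X (\<lambda>x. u x * u x - u x * u (g x)) = variation g u / 2"
proof -
  note p = test_function_product[OF assms(1)]
  note s = p[OF bij_id bij_id] p[OF assms(2,2)] p[OF bij_id assms(2)]
  have "variation g u = sum_X (\<lambda>x. u x * u x + u (g x) * u (g x) - 2 * (u x * u (g x)))"
    unfolding variation_def by (rule arg_cong[where f=sum_X]) (auto simp: power2_eq_square algebra_simps)
  also have "\<dots> = sum_X (\<lambda>x. u x * u x) + sum_X (\<lambda>x. u (g x) * u (g x)) - 2 * sum_X (\<lambda>x. u x * u (g x))"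
    using s by simp
  also have "sum_X (\<lambda>x. u (g x) * u (g x)) = sum_X (\<lambda>x. u x * u x)"
    using sum_perm[OF assms(2), of "\<lambda>x. u x * u x"] .
  finally show ?thesis using s by simp
qed

lemma variation_nonneg: "0 \<le> variation g u"
  unfolding variation_def by simp

text \<open>
  By the preceding identity the energy is the \<open>\<mu>\<close>-mean of \<open>variation g u / 2\<close>.  All terms of this
  mean are nonnegative, so each of them is bounded by the whole.
\<close>
lemma variation_le_energy:
  assumes u: "test_function u" and g: "g \<in> set_pmf \<mu>"
  shows "pmf \<mu> g * variation g u \<le> 2 * energy u"
proof -
  define h where "h = (\<lambda>g x. u x * u x - u x * u (g x))"
  have us: "summable_X u" and ub: "\<And>x. x \<in> X \<Longrightarrow> \<bar>u x\<bar> \<le> 1"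
    using u by (auto simp: test_function_def)
  have h1: "summable_X (h g)" if "g \<in> set_pmf \<mu>" for g
    unfolding h_def using test_function_product[OF u bij_id bij_id] test_function_product[OF u bij_id perm[OF that]]
    by simp
  have "sum_X (\<lambda>x. \<bar>h g x\<bar>) \<le> sum_X (\<lambda>x. 2 * \<bar>u x\<bar>)" if g: "g \<in> set_pmf \<mu>" for g
  proof (rule integral_mono)
    fix x assume "x \<in> space (count_space X)"
    then have x: "x \<in> X" by simp
    have "\<bar>h g x\<bar> = \<bar>u x\<bar> * \<bar>u x - u (g x)\<bar>"
      unfolding h_def by (simp add: abs_mult[symmetric] algebra_simps)
    also have "\<dots> \<le> \<bar>u x\<bar> * 2"
      using ub[OF x] ub[OF perm_in[OF g x]] by (intro mult_left_mono) auto
    finally show "\<bar>h g x\<bar> \<le> 2 * \<bar>u x\<bar>" by simp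
  qed (use h1[OF g] us in auto)
  then have h2: "integrable (measure_pmf \<mu>) (\<lambda>g. sum_X (\<lambda>x. \<bar>h g x\<bar>))"
    by (intro integrable_pmf_bounded[where B="sum_X (\<lambda>x. 2 * \<bar>u x\<bar>)"]) auto
  have h3: "sum_X (h g) = variation g u / 2" if "g \<in> set_pmf \<mu>" for g
    unfolding h_def by (rule variation_expand[OF u perm[OF that]])
  have "energy u = sum_X (\<lambda>x. measure_pmf.expectation \<mu> (\<lambda>g. h g x))"
    unfolding energy_def
  proof (rule Bochner_Integration.integral_cong[OF refl])
    fix x assume "x \<in> space (count_space X)"
    then have x: "x \<in> X" by simp
    have "integrable (measure_pmf \<mu>) (\<lambda>g. u (g x))"
      by (rule integrable_pmf_bounded[where B=1]) (use ub perm_in x in auto)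
    then show "u x * (u x - markov u x) = measure_pmf.expectation \<mu> (\<lambda>g. h g x)"
      unfolding h_def markov_def by (simp add: algebra_simps)
  qed
  also have "\<dots> = measure_pmf.expectation \<mu> (\<lambda>g. sum_X (h g))"
    by (rule sum_expectation) (use h1 h2 in auto)
  finally have e: "energy u = measure_pmf.expectation \<mu> (\<lambda>g. sum_X (h g))" .
  have "pmf \<mu> g * (variation g u / 2) = measure_pmf.expectation \<mu> (\<lambda>k. indicator {g} k * (variation g u / 2))"
    by (simp add: measure_pmf_single)
  also have "\<dots> \<le> measure_pmf.expectation \<mu> (\<lambda>g. sum_X (h g))"
  proof (rule integral_mono_AE)
    show "integrable (measure_pmf \<mu>) (\<lambda>g. sum_X (h g))"
      by (rule integrable_sum) (use h1 h2 in auto)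
    show "AE k in measure_pmf \<mu>. indicator {g} k * (variation g u / 2) \<le> sum_X (h k)"
      using h3 variation_nonneg by (auto simp: AE_measure_pmf_iff indicator_def)
  qed (rule integrable_pmf_bounded[where B="variation g u / 2"], use variation_nonneg in \<open>auto simp: indicator_def\<close>)
  finally show ?thesis using e by simp
qed

definition energy_controlled :: "('a \<Rightarrow> 'a) \<Rightarrow> bool" where
  "energy_controlled g \<longleftrightarrow> bij_betw g X X \<and> (\<exists>K. \<forall>u. test_function u \<longrightarrow> variation g u \<le> K * energy u)"

lemma energy_controlled_step:
  assumes "g \<in> set_pmf \<mu>" shows "energy_controlled g"
  unfolding energy_controlled_def
proof (intro conjI exI allI impI)
  show "bij_betw g X X" by (rule perm[OF assms])
  fix u assume "test_function u"
  from variation_le_energy[OF this assms] show "variation g u \<le> (2 / pmf \<mu> g) * energy u"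
    using pmf_positive[OF assms] by (simp add: field_simps)
qed

text \<open>
  The step from the support of \<open>\<mu>\<close> to the semigroup that it generates.  The squared triangle
  inequality \<open>(p + q)\<^sup>2 \<le> 2 p\<^sup>2 + 2 q\<^sup>2\<close> suffices, because only the existence of a constant matters.
\<close>
lemma energy_controlled_comp:
  assumes "energy_controlled g" "energy_controlled h" shows "energy_controlled (h \<circ> g)"
proof -
  from assms obtain K L where g: "bij_betw g X X" and h: "bij_betw h X X"
    and K: "\<And>u. test_function u \<Longrightarrow> variation g u \<le> K * energy u"
    and L: "\<And>u. test_function u \<Longrightarrow> variation h u \<le> L * energy u"
    unfolding energy_controlled_def by auto
  have hg: "bij_betw (h \<circ> g) X X" using g h by (rule bij_betw_trans)
  have hg': "bij_betw (\<lambda>x. h (g x)) X X" using hg by (simp add: o_def)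
  have "variation (h \<circ> g) u \<le> (2 * K + 2 * L) * energy u" if u: "test_function u" for u
  proof -
    have "variation (h \<circ> g) u \<le> sum_X (\<lambda>x. 2 * (u x - u (g x))\<^sup>2 + 2 * (u (g x) - u (h (g x)))\<^sup>2)"
      unfolding variation_def
    proof (rule integral_mono)
      show "summable_X (\<lambda>x. (u x - u ((h \<circ> g) x))\<^sup>2)"
        by (rule test_function_square[OF u bij_id hg])
      show "summable_X (\<lambda>x. 2 * (u x - u (g x))\<^sup>2 + 2 * (u (g x) - u (h (g x)))\<^sup>2)"
        using test_function_square[OF u bij_id g] test_function_square[OF u g hg'] by simp
      show "(u x - u ((h \<circ> g) x))\<^sup>2 \<le> 2 * (u x - u (g x))\<^sup>2 + 2 * (u (g x) - u (h (g x)))\<^sup>2" for x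
        using sum_squares_bound[of "u x - u (g x)" "u (g x) - u (h (g x))"]
        by (simp add: power2_eq_square algebra_simps)
    qed
    also have "\<dots> = 2 * variation g u + 2 * sum_X (\<lambda>x. (u (g x) - u (h (g x)))\<^sup>2)"
      using test_function_square[OF u bij_id g] test_function_square[OF u g hg'] by (simp add: variation_def)
    also have "sum_X (\<lambda>x. (u (g x) - u (h (g x)))\<^sup>2) = variation h u"
      unfolding variation_def using sum_perm[OF g, of "\<lambda>x. (u x - u (h x))\<^sup>2"] .
    finally show ?thesis using K[OF u] L[OF u] unfolding distrib_right mult.assoc by linarith
  qed
  then show ?thesis using hg unfolding energy_controlled_def by blast
qed

text \<open>
  An isoperimetric inequality.  Let \<open>N\<close> be the \<open>\<ell>\<^sup>2\<close>-mass of \<open>u\<close> on \<open>T\<close>.  Up to a multiple of the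
  variations, \<open>2 N\<close> is at most \<open>3/2\<close> times the sum of the masses on \<open>a ` T\<close> and on \<open>b ` T\<close>.  This sum is at
  most \<open>N\<close>, because the images are disjoint subsets of \<open>T\<close>.
\<close>
lemma sum_branching_le:
  assumes u: "test_function u" and T: "T \<subseteq> X"
    and a: "bij_betw a X X" and b: "bij_betw b X X"
    and aT: "a ` T \<subseteq> T" and bT: "b ` T \<subseteq> T" and disj: "a ` T \<inter> b ` T = {}"
  shows "sum_X (\<lambda>x. indicator T x * (u x)\<^sup>2) \<le> 6 * (variation a u + variation b u)"
proof -
  define w where "w = (\<lambda>x. indicator T x * (u x)\<^sup>2)"
  note sq = test_function_product[OF u bij_id bij_id]
  have sI: "summable_X (\<lambda>x. indicator S x * (u x)\<^sup>2)" for S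
    using summable_X_mult_bounded[OF sq, of "indicator S" 1]
    by (auto simp: power2_eq_square indicator_def mult.commute)
  have sIg: "summable_X (\<lambda>x. indicator T x * (u (g x))\<^sup>2)" if "bij_betw g X X" for g
    using summable_X_mult_bounded[OF test_function_product[OF u that that], of "indicator T" 1]
    by (auto simp: power2_eq_square indicator_def mult.commute)
  have image: "sum_X (\<lambda>x. indicator T x * (u (g x))\<^sup>2) = sum_X (\<lambda>x. indicator (g ` T) x * (u x)\<^sup>2)"
    if g: "bij_betw g X X" for g
  proof -
    have "sum_X (\<lambda>x. indicator T x * (u (g x))\<^sup>2) = sum_X (\<lambda>x. indicator (g ` T) (g x) * (u (g x))\<^sup>2)"
    proof (rule Bochner_Integration.integral_cong[OF refl])
      fix x assume "x \<in> space (count_space X)"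
      then have "g x \<in> g ` T \<longleftrightarrow> x \<in> T"
        using g T by (auto simp: bij_betw_def inj_on_def)
      then show "indicator T x * (u (g x))\<^sup>2 = indicator (g ` T) (g x) * (u (g x))\<^sup>2"
        by (simp add: indicator_def)
    qed
    then show ?thesis using sum_perm[OF g, of "\<lambda>x. indicator (g ` T) x * (u x)\<^sup>2"] by simp
  qed
  have le: "sum_X w \<le> 3/2 * sum_X (\<lambda>x. indicator (g ` T) x * (u x)\<^sup>2) + 3 * variation g u"
    if g: "bij_betw g X X" for g
  proof -
    have "sum_X w \<le> sum_X (\<lambda>x. 3/2 * (indicator T x * (u (g x))\<^sup>2) + 3 * (u x - u (g x))\<^sup>2)"
    proof (rule integral_mono)
      show "summable_X w" unfolding w_def by (rule sI)
      show "summable_X (\<lambda>x. 3/2 * (indicator T x * (u (g x))\<^sup>2) + 3 * (u x - u (g x))\<^sup>2)"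
        using sIg[OF g] test_function_square[OF u bij_id g] by simp
      fix x
      \<comment> \<open>This is \<open>(v + d)\<^sup>2 \<le> 3/2 v\<^sup>2 + 3 d\<^sup>2\<close> for \<open>v = u (g x)\<close> and \<open>d = u x - v\<close>; any factor
        below 2 in front of \<open>v\<^sup>2\<close> would serve.\<close>
      have "0 \<le> (u (g x) - 2 * (u x - u (g x)))\<^sup>2" by simp
      then have "(u x)\<^sup>2 \<le> 3/2 * (u (g x))\<^sup>2 + 3 * (u x - u (g x))\<^sup>2"
        by (simp add: power2_eq_square algebra_simps)
      then show "w x \<le> 3/2 * (indicator T x * (u (g x))\<^sup>2) + 3 * (u x - u (g x))\<^sup>2"
        by (simp add: w_def indicator_def)
    qed
    also have "\<dots> = 3/2 * sum_X (\<lambda>x. indicator T x * (u (g x))\<^sup>2) + 3 * variation g u"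
      using sIg[OF g] test_function_square[OF u bij_id g] by (simp add: variation_def)
    finally show ?thesis using image[OF g] by simp
  qed
  have "sum_X (\<lambda>x. indicator (a ` T) x * (u x)\<^sup>2) + sum_X (\<lambda>x. indicator (b ` T) x * (u x)\<^sup>2)
      = sum_X (\<lambda>x. indicator (a ` T) x * (u x)\<^sup>2 + indicator (b ` T) x * (u x)\<^sup>2)"
    using sI by simp
  also have "\<dots> \<le> sum_X w"
    by (rule integral_mono) (use sI aT bT disj in \<open>auto simp: w_def indicator_def\<close>)
  finally have ab: "sum_X (\<lambda>x. indicator (a ` T) x * (u x)\<^sup>2)
      + sum_X (\<lambda>x. indicator (b ` T) x * (u x)\<^sup>2) \<le> sum_X w" .
  have "w \<le> 6 * (v + v')" if "p + q \<le> w" "w \<le> 3/2 * p + 3 * v" "w \<le> 3/2 * q + 3 * v'"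
    for w p q v v' :: real
    using that by simp
  from this[OF ab le[OF a] le[OF b]] show ?thesis unfolding w_def .
qed

section \<open>Harmonic functions from almost invariant sets\<close>

lemma markov_unit_interval:
  assumes "\<And>x. x \<in> X \<Longrightarrow> f x \<in> {0..1}" "x \<in> X"
  shows "markov f x \<in> {0..1}"
proof -
  have b: "\<And>g. g \<in> set_pmf \<mu> \<Longrightarrow> f (g x) \<in> {0..1}" using assms perm_in by blast
  have i: "integrable (measure_pmf \<mu>) (\<lambda>g. f (g x))"
    by (rule integrable_pmf_bounded[where B=1]) (use b in force)
  have "0 \<le> markov f x" unfolding markov_def
    by (rule integral_nonneg_AE) (use b in \<open>force simp: AE_measure_pmf_iff\<close>)
  moreover have "markov f x \<le> 1" unfolding markov_def
    by (rule measure_pmf.integral_le_const[OF i]) (use b in \<open>force simp: AE_measure_pmf_iff\<close>)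
  ultimately show ?thesis by simp
qed

lemma integrable_markov:
  assumes "\<And>x. x \<in> X \<Longrightarrow> f x \<in> {0..1::real}" "x \<in> X"
  shows "integrable (measure_pmf \<mu>) (\<lambda>g. f (g x))"
  by (rule integrable_pmf_bounded[where B=1]) (use assms perm_in in force)

definition drift :: "'a set \<Rightarrow> 'a \<Rightarrow> real" where
  "drift A x = markov (indicator A) x - indicator A x"

text \<open>
  The \<open>\<ell>\<^sup>1\<close>-norm of the drift is at most the expected number of points that one step moves
  across the boundary of \<open>A\<close>.
\<close>
lemma drift_summable:
  assumes fin: "\<And>g. g \<in> set_pmf \<mu> \<Longrightarrow> finite (moved_points X A g)"
    and int: "integrable (measure_pmf \<mu>) (\<lambda>g. real (card (moved_points X A g)))"
  shows "summable_X (drift A)"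
proof -
  define h :: "('a \<Rightarrow> 'a) \<Rightarrow> 'a \<Rightarrow> real" where "h = (\<lambda>g x. indicator A (g x) - indicator A x)"
  have h_eq: "\<bar>h g x\<bar> = indicator (moved_points X A g) x" if "x \<in> X" for g x
    using that by (auto simp: h_def moved_points_def indicator_def)
  have s: "summable_X (indicator (moved_points X A g) :: 'a \<Rightarrow> real)" if "g \<in> set_pmf \<mu>" for g
    using fin[OF that] by (intro integrable_real_indicator) (auto simp: moved_points_def less_top[symmetric])
  have h1: "summable_X (h g)" if "g \<in> set_pmf \<mu>" for g
    by (rule Bochner_Integration.integrable_bound[OF s[OF that]]) (auto simp: AE_count_space h_eq)
  have h2: "sum_X (\<lambda>x. \<bar>h g x\<bar>) = real (card (moved_points X A g))" if "g \<in> set_pmf \<mu>" for g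
  proof -
    have "sum_X (\<lambda>x. \<bar>h g x\<bar>) = sum_X (indicator (moved_points X A g))"
      by (rule Bochner_Integration.integral_cong) (auto simp: h_eq)
    also have "\<dots> = real (card (moved_points X A g))"
    proof -
      have "moved_points X A g \<subseteq> X" by (auto simp: moved_points_def)
      then show ?thesis using fin[OF that] by (simp add: measure_count_space Int_absorb2)
    qed
    finally show ?thesis .
  qed
  have h3: "integrable (measure_pmf \<mu>) (\<lambda>g. sum_X (\<lambda>x. \<bar>h g x\<bar>))"
    by (rule integrable_cong_AE_imp[OF int]) (auto simp: AE_measure_pmf_iff h2)
  have "drift A = (\<lambda>x. measure_pmf.expectation \<mu> (\<lambda>g. h g x))"
  proof
    fix x
    have "integrable (measure_pmf \<mu>) (\<lambda>g. indicator A (g x) :: real)"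
      by (rule integrable_pmf_bounded[where B=1]) (auto simp: indicator_def)
    then show "drift A x = measure_pmf.expectation \<mu> (\<lambda>g. h g x)"
      by (simp add: drift_def markov_def h_def)
  qed
  then show ?thesis using summable_expectation[OF h1 h3] by simp
qed

abbreviation iterate :: "'a set \<Rightarrow> nat \<Rightarrow> 'a \<Rightarrow> real" where
  "iterate A n \<equiv> (markov ^^ n) (indicator A)"

lemma iterate_unit_interval: "x \<in> X \<Longrightarrow> iterate A n x \<in> {0..1}"
proof (induction n arbitrary: x)
  case (Suc n)
  then show ?case using markov_unit_interval[of "iterate A n" x] by simp
qed (auto simp: indicator_def)

text \<open>
  The difference telescopes into \<open>n\<close> images of the drift under powers of the \<open>\<ell>\<^sup>1\<close>-contraction.
\<close>
lemma iterate_diff: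
  assumes "summable_X (drift A)"
  shows "summable_X (\<lambda>x. iterate A n x - indicator A x)
    \<and> sum_X (\<lambda>x. \<bar>iterate A n x - indicator A x\<bar>) \<le> real n * sum_X (\<lambda>x. \<bar>drift A x\<bar>)"
proof (induction n)
  case (Suc n)
  define v where "v = (\<lambda>x. iterate A n x - indicator A x)"
  have v: "summable_X v" "sum_X (\<lambda>x. \<bar>v x\<bar>) \<le> real n * sum_X (\<lambda>x. \<bar>drift A x\<bar>)"
    using Suc by (auto simp: v_def)
  have eq: "iterate A (Suc n) x - indicator A x = markov v x + drift A x" if "x \<in> X" for x
  proof -
    have "integrable (measure_pmf \<mu>) (\<lambda>g. iterate A n (g x))"
      by (rule integrable_markov[OF iterate_unit_interval that])
    moreover have "integrable (measure_pmf \<mu>) (\<lambda>g. indicator A (g x) :: real)"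
      by (rule integrable_pmf_bounded[where B=1]) (auto simp: indicator_def)
    ultimately have "markov v x = markov (iterate A n) x - markov (indicator A) x"
      by (simp add: markov_def v_def)
    then show ?thesis by (simp add: drift_def)
  qed
  have s: "summable_X (\<lambda>x. markov v x + drift A x)"
    using markov_summable(1)[OF v(1)] assms by simp
  have "summable_X (\<lambda>x. iterate A (Suc n) x - indicator A x)"
    using s by (rule Bochner_Integration.integrable_cong[THEN iffD1, rotated 2]) (simp_all add: eq del: funpow.simps)
  moreover have "sum_X (\<lambda>x. \<bar>iterate A (Suc n) x - indicator A x\<bar>)
      = sum_X (\<lambda>x. \<bar>markov v x + drift A x\<bar>)"
    by (rule Bochner_Integration.integral_cong) (simp_all add: eq del: funpow.simps)
  moreover have "\<dots> \<le> sum_X (\<lambda>x. \<bar>markov v x\<bar> + \<bar>drift A x\<bar>)"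
    by (rule integral_mono) (use s markov_summable(1)[OF v(1)] assms in auto)
  moreover have "\<dots> = sum_X (\<lambda>x. \<bar>markov v x\<bar>) + sum_X (\<lambda>x. \<bar>drift A x\<bar>)"
    using markov_summable(1)[OF v(1)] assms by simp
  moreover have "sum_X (\<lambda>x. \<bar>markov v x\<bar>) \<le> real n * sum_X (\<lambda>x. \<bar>drift A x\<bar>)"
    using markov_summable(2)[OF v(1)] v(2) by simp
  ultimately show ?case by (simp add: algebra_simps del: funpow.simps)
qed simp

definition cesaro :: "'a set \<Rightarrow> nat \<Rightarrow> 'a \<Rightarrow> real" where
  "cesaro A N x = (\<Sum>n<N. iterate A n x) / real N"

lemma cesaro_unit_interval:
  assumes "x \<in> X" shows "cesaro A N x \<in> {0..1}"
proof -
  have "(\<Sum>n<N. iterate A n x) \<le> (\<Sum>n<N. 1)" 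
    using iterate_unit_interval[OF assms] by (intro sum_mono) auto
  moreover have "0 \<le> (\<Sum>n<N. iterate A n x)"
    using iterate_unit_interval[OF assms] by (intro sum_nonneg) auto
  ultimately show ?thesis unfolding cesaro_def by (auto simp: divide_le_eq_1)
qed

lemma cesaro_almost_harmonic:
  assumes "x \<in> X"
  shows "cesaro A N x - markov (cesaro A N) x = (indicator A x - iterate A N x) / real N"
proof -
  have i: "integrable (measure_pmf \<mu>) (\<lambda>g. iterate A n (g x))" for n
    by (rule integrable_markov[OF iterate_unit_interval assms])
  have "markov (cesaro A N) x = (\<Sum>n<N. measure_pmf.expectation \<mu> (\<lambda>g. iterate A n (g x))) / real N"
    using i by (simp add: markov_def[of "cesaro A N"] cesaro_def Bochner_Integration.integral_sum)
  also have "\<dots> = (\<Sum>n<N. iterate A (Suc n) x) / real N"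
    by (simp add: markov_def)
  finally have "cesaro A N x - markov (cesaro A N) x
      = (\<Sum>n<N. iterate A n x - iterate A (Suc n) x) / real N"
    by (simp add: cesaro_def diff_divide_distrib sum_subtractf)
  also have "(\<Sum>n<N. iterate A n x - iterate A (Suc n) x) = indicator A x - iterate A N x"
    by (subst sum_lessThan_telescope') simp
  finally show ?thesis .
qed

text \<open>
  With \<open>u = cesaro A N - 1\<^sub>A\<close>, the function \<open>u - P u\<close> is \<open>(1\<^sub>A - P\<^sup>N 1\<^sub>A) / N\<close> plus the drift.  The first
  summand has \<open>\<ell>\<^sup>1\<close>-norm at most that of the drift, since the bound of \<open>iterate_diff\<close> grows only
  linearly in \<open>N\<close>.  Pairing with \<open>u\<close>, which is bounded by \<open>1\<close>, gives a bound independent of \<open>N\<close>.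
\<close>
lemma cesaro_energy:
  assumes d: "summable_X (drift A)" and N: "N > 0"
  shows "test_function (\<lambda>x. cesaro A N x - indicator A x)" (is "test_function ?u")
    and "energy (\<lambda>x. cesaro A N x - indicator A x) \<le> 2 * sum_X (\<lambda>x. \<bar>drift A x\<bar>)"
proof -
  have "?u = (\<lambda>x. (\<Sum>n<N. iterate A n x - indicator A x) / real N)"
    using N by (auto simp: cesaro_def sum_subtractf diff_divide_distrib)
  then have us: "summable_X ?u"
    using iterate_diff[OF d] by simp
  have ub: "\<bar>?u x\<bar> \<le> 1" if "x \<in> X" for x
    using cesaro_unit_interval[OF that, of A N] by (auto simp: indicator_def)
  show "test_function ?u" using us ub by (simp add: test_function_def)
  define r where "r = (\<lambda>x. (indicator A x - iterate A N x) / real N + drift A x)"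
  have eq: "?u x - markov ?u x = r x" if "x \<in> X" for x
  proof -
    have "integrable (measure_pmf \<mu>) (\<lambda>g. cesaro A N (g x))"
      by (rule integrable_markov[OF cesaro_unit_interval that])
    moreover have "integrable (measure_pmf \<mu>) (\<lambda>g. indicator A (g x) :: real)"
      by (rule integrable_pmf_bounded[where B=1]) (auto simp: indicator_def)
    ultimately have "markov ?u x = markov (cesaro A N) x - markov (indicator A) x"
      by (simp add: markov_def)
    then show ?thesis using cesaro_almost_harmonic[OF that, of A N] by (simp add: r_def drift_def)
  qed
  have s1: "summable_X (\<lambda>x. iterate A N x - indicator A x)"
    and s2: "sum_X (\<lambda>x. \<bar>iterate A N x - indicator A x\<bar>) \<le> real N * sum_X (\<lambda>x. \<bar>drift A x\<bar>)"
    using iterate_diff[OF d] by auto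
  have rs: "summable_X r"
  proof -
    have "r = (\<lambda>x. - ((iterate A N x - indicator A x) / real N) + drift A x)"
      by (auto simp: r_def diff_divide_distrib)
    then show ?thesis using s1 d by simp
  qed
  have ru: "summable_X (\<lambda>x. r x * ?u x)"
    by (rule summable_X_mult_bounded[OF rs ub])
  have "energy ?u = sum_X (\<lambda>x. r x * ?u x)"
    unfolding energy_def by (rule Bochner_Integration.integral_cong) (simp_all add: eq)
  also have "\<dots> \<le> sum_X (\<lambda>x. \<bar>iterate A N x - indicator A x\<bar> / real N + \<bar>drift A x\<bar>)"
  proof (rule integral_mono[OF ru])
    show "summable_X (\<lambda>x. \<bar>iterate A N x - indicator A x\<bar> / real N + \<bar>drift A x\<bar>)"
      using s1 d by simp
    fix x assume "x \<in> space (count_space X)"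
    then have x: "x \<in> X" by simp
    have "r x * ?u x \<le> \<bar>r x\<bar> * \<bar>?u x\<bar>" by (metis abs_ge_self abs_mult)
    also have "\<dots> \<le> \<bar>r x\<bar> * 1" by (rule mult_left_mono) (use ub[OF x] in auto)
    also have "\<dots> \<le> \<bar>(indicator A x - iterate A N x) / real N\<bar> + \<bar>drift A x\<bar>"
      unfolding r_def mult_1_right by (rule abs_triangle_ineq)
    also have "\<bar>(indicator A x - iterate A N x) / real N\<bar> = \<bar>iterate A N x - indicator A x\<bar> / real N"
      by (simp add: abs_minus_commute)
    finally show "r x * ?u x \<le> \<bar>iterate A N x - indicator A x\<bar> / real N + \<bar>drift A x\<bar>" .
  qed
  also have "\<dots> = sum_X (\<lambda>x. \<bar>iterate A N x - indicator A x\<bar>) / real N + sum_X (\<lambda>x. \<bar>drift A x\<bar>)"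
    using s1 d by simp
  also have "\<dots> \<le> 2 * sum_X (\<lambda>x. \<bar>drift A x\<bar>)"
    using s2 N by (simp add: divide_le_eq mult.commute)
  finally show "energy ?u \<le> 2 * sum_X (\<lambda>x. \<bar>drift A x\<bar>)" .
qed

lemma infinite_const_square_sum:
  fixes c M :: real
  assumes "infinite S" "\<And>F. finite F \<Longrightarrow> F \<subseteq> S \<Longrightarrow> (\<Sum>x\<in>F. c\<^sup>2) \<le> M"
  shows "c = 0"
proof (rule ccontr)
  assume "c \<noteq> 0"
  then have c: "c\<^sup>2 > 0" by simp
  obtain n :: nat where n: "real n > M / c\<^sup>2" using reals_Archimedean2 by blast
  obtain F where "F \<subseteq> S" "finite F" "card F = n"
    using infinite_arbitrarily_large[OF assms(1)] by blast
  with assms(2)[of F] n c show False by (simp add: field_simps)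
qed

text \<open>
  The averages have a pointwise convergent subsequence, as \<open>X\<close> is countable.  The limit is
  harmonic because the averages are harmonic up to \<open>1/N\<close>.  The uniform bound on the mass of
  \<open>cesaro A N - 1\<^sub>A\<close> over finite subsets of \<open>T\<close> survives the limit, which excludes a constant \<open>c\<close>:
  it would have to agree with \<open>1\<close> on \<open>T \<inter> A\<close> and with \<open>0\<close> on \<open>T - A\<close>.
\<close>
theorem nonconstant_harmonic:
  assumes fin: "\<And>g. g \<in> set_pmf \<mu> \<Longrightarrow> finite (moved_points X A g)"
    and int: "integrable (measure_pmf \<mu>) (\<lambda>g. real (card (moved_points X A g)))"
    and a: "energy_controlled a" and b: "energy_controlled b"
    and T: "T \<subseteq> X" "a ` T \<subseteq> T" "b ` T \<subseteq> T" "a ` T \<inter> b ` T = {}"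
    and inf: "infinite (T \<inter> A)" "infinite (T - A)"
  obtains f where "\<And>x. x \<in> X \<Longrightarrow> f x \<in> {0..1}" "\<And>x. x \<in> X \<Longrightarrow> markov f x = f x"
    "\<not> f constant_on X"
proof -
  have d: "summable_X (drift A)" by (rule drift_summable[OF fin int])
  from a b obtain K L where bij: "bij_betw a X X" "bij_betw b X X"
    and K: "\<And>u. test_function u \<Longrightarrow> variation a u \<le> K * energy u"
    and L: "\<And>u. test_function u \<Longrightarrow> variation b u \<le> L * energy u"
    unfolding energy_controlled_def by auto
  define M where "M = 6 * ((\<bar>K\<bar> + \<bar>L\<bar>) * (2 * sum_X (\<lambda>x. \<bar>drift A x\<bar>)))"
  have bound: "(\<Sum>x\<in>F. (cesaro A N x - indicator A x)\<^sup>2) \<le> M"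
    if F: "finite F" "F \<subseteq> T" and N: "N > 0" for F N
  proof -
    define u where "u = (\<lambda>x. cesaro A N x - indicator A x)"
    have u: "test_function u" and e: "energy u \<le> 2 * sum_X (\<lambda>x. \<bar>drift A x\<bar>)"
      using cesaro_energy[OF d N] by (auto simp: u_def)
    have FX: "F \<subseteq> X" using F T by auto
    have sI: "summable_X (\<lambda>x. indicator S x * (u x)\<^sup>2)" for S
      using summable_X_mult_bounded[OF test_function_product[OF u bij_id bij_id], of "indicator S" 1]
      by (auto simp: power2_eq_square indicator_def mult.commute)
    have "(\<Sum>x\<in>F. (u x)\<^sup>2) = sum_X (\<lambda>x. indicator F x * (u x)\<^sup>2)"
    proof -
      let ?w = "\<lambda>x. indicator F x * (u x)\<^sup>2" and ?S = "{x \<in> X. indicator F x * (u x)\<^sup>2 \<noteq> 0}"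
      have S: "?S \<subseteq> F" by (auto simp: indicator_def)
      have "sum_X ?w = (\<Sum>x\<in>?S. ?w x)"
        by (rule lebesgue_integral_count_space_finite_support[OF finite_subset[OF S F(1)]])
      also have "\<dots> = (\<Sum>x\<in>F. (u x)\<^sup>2)"
        by (rule sum.mono_neutral_cong_left[OF F(1) S]) (use FX in \<open>auto simp: indicator_def split: if_splits\<close>)
      finally show ?thesis by simp
    qed
    also have "\<dots> \<le> sum_X (\<lambda>x. indicator T x * (u x)\<^sup>2)"
      by (rule integral_mono) (use sI F in \<open>auto simp: indicator_def\<close>)
    also have "\<dots> \<le> 6 * (variation a u + variation b u)"
      by (rule sum_branching_le[OF u T(1) bij T(2-4)])
    also have "\<dots> \<le> 6 * ((\<bar>K\<bar> + \<bar>L\<bar>) * energy u)"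
    proof -
      have "0 \<le> energy u"
      proof -
        obtain g where g: "g \<in> set_pmf \<mu>" using set_pmf_not_empty[of \<mu>] by blast
        have "0 \<le> pmf \<mu> g * variation g u" using variation_nonneg by simp
        then show ?thesis using variation_le_energy[OF u g] by linarith
      qed
      then have "K * energy u \<le> \<bar>K\<bar> * energy u" "L * energy u \<le> \<bar>L\<bar> * energy u"
        by (auto intro: mult_right_mono)
      then show ?thesis unfolding distrib_right
        by (intro mult_left_mono add_mono) (auto intro: order_trans K[OF u] L[OF u])
    qed
    also have "\<dots> \<le> M" unfolding M_def
      by (intro mult_left_mono e) auto
    finally show ?thesis unfolding u_def .
  qed
  have bd: "norm (cesaro A (Suc n) x) \<le> 1" if "x \<in> X" for n x
    using cesaro_unit_interval[OF that, of A "Suc n"] by simp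
  obtain k where k: "strict_mono (k :: nat \<Rightarrow> nat)"
    and conv: "\<And>x. x \<in> X \<Longrightarrow> \<exists>l. (\<lambda>n. cesaro A (Suc (k n)) x) \<longlonglongrightarrow> l"
    using function_convergent_subsequence[where f="\<lambda>n. cesaro A (Suc n)", OF countable_X bd] by blast
  define f where "f x = lim (\<lambda>n. cesaro A (Suc (k n)) x)" for x
  have f: "(\<lambda>n. cesaro A (Suc (k n)) x) \<longlonglongrightarrow> f x" if "x \<in> X" for x
    using conv[OF that] unfolding f_def by (metis limI)
  have f01: "f x \<in> {0..1}" if "x \<in> X" for x
    by (rule closed_sequentially[OF closed_atLeastAtMost cesaro_unit_interval[OF that] f[OF that]])
  have harm: "markov f x = f x" if x: "x \<in> X" for x
  proof -
    have "(\<lambda>n. markov (cesaro A (Suc (k n))) x) \<longlonglongrightarrow> markov f x"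
      unfolding markov_def
    proof (rule integral_dominated_convergence[where w="\<lambda>_. 1"])
      show "AE g in measure_pmf \<mu>. (\<lambda>n. cesaro A (Suc (k n)) (g x)) \<longlonglongrightarrow> f (g x)"
        using f perm_in x by (simp add: AE_measure_pmf_iff)
      show "AE g in measure_pmf \<mu>. norm (cesaro A (Suc (k n)) (g x)) \<le> 1" for n
        using bd perm_in x by (simp add: AE_measure_pmf_iff)
    qed auto
    moreover have "(\<lambda>n. cesaro A (Suc (k n)) x - markov (cesaro A (Suc (k n))) x) \<longlonglongrightarrow> 0"
    proof (rule Lim_null_comparison)
      show "\<forall>\<^sub>F n in sequentially. norm (cesaro A (Suc (k n)) x - markov (cesaro A (Suc (k n))) x) \<le> inverse (real (Suc (k n)))"
      proof (intro always_eventually allI)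
        fix n
        have "\<bar>indicator A x - iterate A (Suc (k n)) x\<bar> \<le> 1"
          using iterate_unit_interval[OF x, where A=A and n="Suc (k n)"]
          by (auto simp: indicator_def simp del: funpow.simps)
        then show "norm (cesaro A (Suc (k n)) x - markov (cesaro A (Suc (k n))) x) \<le> inverse (real (Suc (k n)))"
          unfolding cesaro_almost_harmonic[OF x]
          using divide_right_mono[of _ 1 "real (Suc (k n))"]
          by (simp add: abs_divide inverse_eq_divide del: funpow.simps)
      qed
      show "(\<lambda>n. inverse (real (Suc (k n)))) \<longlonglongrightarrow> 0"
        using LIMSEQ_subseq_LIMSEQ[OF LIMSEQ_inverse_real_of_nat k] by (simp add: o_def)
    qed
    ultimately have "(\<lambda>n. cesaro A (Suc (k n)) x) \<longlonglongrightarrow> 0 + markov f x"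
      by (auto dest: tendsto_add)
    then show ?thesis using LIMSEQ_unique[OF f[OF x]] by simp
  qed
  have fb: "(\<Sum>x\<in>F. (f x - indicator A x)\<^sup>2) \<le> M" if F: "finite F" "F \<subseteq> T" for F
  proof (rule LIMSEQ_le_const2)
    show "(\<lambda>n. \<Sum>x\<in>F. (cesaro A (Suc (k n)) x - indicator A x)\<^sup>2) \<longlonglongrightarrow> (\<Sum>x\<in>F. (f x - indicator A x)\<^sup>2)"
      using F T by (intro tendsto_intros f) auto
  qed (use bound[OF F] in auto)
  have "\<not> f constant_on X"
  proof
    assume "f constant_on X"
    then obtain c where c: "\<And>x. x \<in> X \<Longrightarrow> f x = c" unfolding constant_on_def by auto
    have cT: "f x = c" if "x \<in> T" for x using c T(1) that by blast
    have "c - 1 = 0"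
    proof (rule infinite_const_square_sum[OF inf(1)])
      fix F assume F: "finite F" "F \<subseteq> T \<inter> A"
      have "(\<Sum>x\<in>F. (c - 1)\<^sup>2) = (\<Sum>x\<in>F. (f x - indicator A x)\<^sup>2)"
        proof (rule sum.cong)
        fix x assume "x \<in> F"
        then have "f x - indicator A x = c - 1" using F cT[of x] by (auto simp: indicator_def)
        then show "(c - 1)\<^sup>2 = (f x - indicator A x)\<^sup>2" by simp
      qed simp
      then show "(\<Sum>x\<in>F. (c - 1)\<^sup>2) \<le> M" using fb[of F] F by simp
    qed
    moreover have "c = 0"
    proof (rule infinite_const_square_sum[OF inf(2)])
      fix F assume F: "finite F" "F \<subseteq> T - A"
      have "(\<Sum>x\<in>F. c\<^sup>2) = (\<Sum>x\<in>F. (f x - indicator A x)\<^sup>2)"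
        proof (rule sum.cong)
        fix x assume "x \<in> F"
        then have "f x - indicator A x = c" using F cT[of x] by (auto simp: indicator_def)
        then show "c\<^sup>2 = (f x - indicator A x)\<^sup>2" by simp
      qed simp
      then show "(\<Sum>x\<in>F. c\<^sup>2) \<le> M" using fb[of F] F by auto
    qed
    ultimately show False by simp
  qed
  then show ?thesis using that f01 harm by blast
qed

end

section \<open>Dyadic rationals and dyadic piecewise linear maps\<close>

lemma dyadic_of_int_powi [simp]: "of_int a * 2 powi b \<in> dyadic_rationals"
  unfolding dyadic_rationals_def by blast

lemma dyadicE:
  assumes "x \<in> dyadic_rationals" obtains a :: int and b :: int where "x = of_int a * 2 powi b"
  using assms unfolding dyadic_rationals_def by blast

lemma powi_split: "(2::real) powi b = 2 powi c * of_int (2 ^ nat (b - c))" if "c \<le> b"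
proof -
  have "(2::real) powi b = 2 powi (c + (b - c))" by simp
  also have "\<dots> = 2 powi c * 2 powi (b - c)" by (rule power_int_add) simp
  also have "(2::real) powi (b - c) = of_int (2 ^ nat (b - c))"
    using that by (simp add: power_int_def)
  finally show ?thesis .
qed

lemma dyadic_common_exponent:
  assumes "x \<in> dyadic_rationals" "y \<in> dyadic_rationals"
  obtains a a' b :: int where "x = of_int a * 2 powi b" "y = of_int a' * 2 powi b"
proof -
  from assms(1) obtain a b :: int where x: "x = of_int a * 2 powi b" by (rule dyadicE)
  from assms(2) obtain a' b' :: int where y: "y = of_int a' * 2 powi b'" by (rule dyadicE)
  define c where "c = min b b'"
  have "x = of_int (a * 2 ^ nat (b - c)) * 2 powi c" "y = of_int (a' * 2 ^ nat (b' - c)) * 2 powi c"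
    using powi_split[of c b] powi_split[of c b'] by (simp_all add: x y c_def)
  then show ?thesis using that by blast
qed

lemma dyadic_diff:
  assumes "x \<in> dyadic_rationals" "y \<in> dyadic_rationals"
  shows "x - y \<in> dyadic_rationals"
proof -
  from dyadic_common_exponent[OF assms] obtain a a' b :: int
    where "x = of_int a * 2 powi b" "y = of_int a' * 2 powi b" .
  then have "x - y = of_int (a - a') * 2 powi b" by (simp add: algebra_simps)
  then show ?thesis by (simp only: dyadic_of_int_powi)
qed

lemma dyadic_add:
  assumes "x \<in> dyadic_rationals" "y \<in> dyadic_rationals"
  shows "x + y \<in> dyadic_rationals"
proof -
  from dyadic_common_exponent[OF assms] obtain a a' b :: int
    where "x = of_int a * 2 powi b" "y = of_int a' * 2 powi b" .
  then have "x + y = of_int (a + a') * 2 powi b" by (simp add: algebra_simps)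
  then show ?thesis by (simp only: dyadic_of_int_powi)
qed

lemma dyadic_mult_powi:
  assumes "x \<in> dyadic_rationals" shows "2 powi k * x \<in> dyadic_rationals"
proof -
  from assms obtain a b :: int where "x = of_int a * 2 powi b" by (rule dyadicE)
  then have "2 powi k * x = of_int a * 2 powi (k + b)" by (simp add: power_int_add)
  then show ?thesis by (simp only: dyadic_of_int_powi)
qed

lemma dyadic_0: "0 \<in> dyadic_rationals" and dyadic_1: "1 \<in> dyadic_rationals"
  using dyadic_of_int_powi[of 0 0] dyadic_of_int_powi[of 1 0] by simp_all

lemma countable_dyadic_points: "countable dyadic_points"
proof -
  have "dyadic_rationals = (\<lambda>(a::int, b::int). of_int a * 2 powi b) ` UNIV"
    unfolding dyadic_rationals_def by auto
  moreover have "countable ((\<lambda>(a::int, b::int). of_int a * 2 powi b :: real) ` UNIV)"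
    by (rule countable_image) simp
  ultimately have "countable dyadic_rationals" by (simp only:)
  then show ?thesis unfolding dyadic_points_def by (rule countable_subset[rotated]) auto
qed

lemma thompson_maps_endpoints:
  assumes "f \<in> thompson_maps" shows "f 0 = 0" "f 1 = 1"
proof -
  have b: "bij_betw f {0..1} {0..1}" and m: "strict_mono_on {0..1} f"
    using assms by (auto simp: thompson_maps_def)
  have "0 \<in> f ` {0..1}" "1 \<in> f ` {0..1}" using b by (auto simp: bij_betw_def)
  then obtain x y where x: "x \<in> {0..1}" "f x = 0" and y: "y \<in> {0..1}" "f y = 1" by force
  have "f 0 \<in> {0..1}" "f 1 \<in> {0..1}" using b by (auto simp: bij_betw_def)
  then show "f 0 = 0" "f 1 = 1"
    using strict_mono_onD[OF m, of 0 x] strict_mono_onD[OF m, of y 1] x y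
    by (auto simp: less_eq_real_def)
qed

text \<open>
  The constant terms are dyadic because \<open>f\<close> maps break points to dyadic numbers, as one sees from
  left to right: at a break point \<open>m\<close> with predecessor \<open>a\<close>, the value \<open>f m\<close> differs from \<open>f a\<close> by a power of
  two times the dyadic number \<open>m - a\<close>, and \<open>f 0 = 0\<close>.
\<close>
lemma thompson_maps_dyadic_pieces:
  assumes f: "f \<in> thompson_maps"
  shows "\<exists>Q :: (int \<times> real) set. finite Q \<and> snd ` Q \<subseteq> dyadic_rationals
           \<and> (\<forall>x\<in>{0..1}. \<exists>(k, c)\<in>Q. f x = 2 powi k * x + c)"
proof -
  have "\<exists>B. finite B \<and> B \<subseteq> dyadic_rationals \<and>
        (\<forall>a b. 0 \<le> a \<and> a < b \<and> b \<le> 1 \<and> {a<..<b} \<inter> B = {} \<longrightarrow>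
           (\<exists>(k::int) (c::real). \<forall>x\<in>{a..b}. f x = 2 powi k * x + c))"
    using f unfolding thompson_maps_def by (elim CollectE conjE)
  then obtain B where B: "finite B" "B \<subseteq> dyadic_rationals"
    and aff0: "\<forall>a b. 0 \<le> a \<and> a < b \<and> b \<le> 1 \<and> {a<..<b} \<inter> B = {} \<longrightarrow>
           (\<exists>(k::int) (c::real). \<forall>x\<in>{a..b}. f x = 2 powi k * x + c)"
    by (elim exE conjE)
  have aff: "\<exists>(k::int) (c::real). \<forall>x\<in>{a..b}. f x = 2 powi k * x + c"
    if "0 \<le> a" "a < b" "b \<le> 1" "{a<..<b} \<inter> B = {}" for a b
    using aff0[rule_format, of a b] that by simp
  define C where "C = {0, 1} \<union> (B \<inter> {0..1})"
  have C: "finite C" "C \<subseteq> dyadic_rationals" "C \<subseteq> {0..1}" "0 \<in> C" "1 \<in> C"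
    using B dyadic_0 dyadic_1 by (auto simp: C_def)
  have gap: "\<exists>b\<in>C. a < b \<and> {a<..<b} \<inter> B = {}" if a: "a \<in> C" "a < 1" for a
  proof -
    let ?U = "{b \<in> C. a < b}"
    have U: "finite ?U" "1 \<in> ?U" using C a by auto
    then have "Min ?U \<in> ?U" by (intro Min_in) auto
    moreover have "{a<..<Min ?U} \<inter> B = {}"
    proof (rule ccontr)
      assume "{a<..<Min ?U} \<inter> B \<noteq> {}"
      then obtain z where z: "a < z" "z < Min ?U" "z \<in> B" by auto
      have "Min ?U \<le> 1" using U by simp
      then have "z \<in> ?U" using z a C(3) by (auto simp: C_def)
      then show False using Min_le[OF U(1)] z(2) by (meson not_less)
    qed
    ultimately show ?thesis by blast
  qed
  have piece: "\<exists>k c. \<exists>b\<in>C. a < b \<and> {a<..<b} \<inter> B = {} \<and> (\<forall>x\<in>{a..b}. f x = 2 powi k * x + c)"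
    if a: "a \<in> C" "a < 1" for a
  proof -
    from gap[OF a] obtain b where b: "b \<in> C" "a < b" "{a<..<b} \<inter> B = {}" by blast
    moreover have "0 \<le> a" "b \<le> 1" using a b C(3) by auto
    ultimately show ?thesis using aff[of a b] by blast
  qed
  have below: "\<exists>a\<in>C. a < 1 \<and> a < y \<and> {a<..<y} \<inter> C = {}" if y: "0 < y" "y \<le> 1" for y
  proof -
    let ?L = "{a \<in> C. a < y}"
    have L: "finite ?L" "0 \<in> ?L" using C y by auto
    then have "Max ?L \<in> ?L" by (intro Max_in) auto
    moreover have "{Max ?L<..<y} \<inter> C = {}"
      using Max_ge[OF L(1)] by force
    ultimately show ?thesis using y by (intro bexI[of _ "Max ?L"]) auto
  qed
  have dy: "f a \<in> dyadic_rationals" if "a \<in> C" for a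
  proof (rule ccontr)
    assume na: "f a \<notin> dyadic_rationals"
    \<comment> \<open>Induction along the break points, as a smallest counterexample.\<close>
    let ?N = "{a \<in> C. f a \<notin> dyadic_rationals}"
    have N: "finite ?N" "?N \<noteq> {}" using C na that by auto
    define m where "m = Min ?N"
    have m: "m \<in> C" "f m \<notin> dyadic_rationals" using Min_in[OF N] by (auto simp: m_def)
    have "m \<noteq> 0" using m(2) thompson_maps_endpoints(1)[OF f] dyadic_0 by auto
    then have "0 < m" "m \<le> 1" using m C(3) by auto
    from below[OF this] obtain a where a: "a \<in> C" "a < 1" "a < m" "{a<..<m} \<inter> C = {}" by blast
    from piece[OF a(1,2)] obtain k c b where b: "b \<in> C" "a < b"
      and e: "\<forall>x\<in>{a..b}. f x = 2 powi k * x + c" by blast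
    have mb: "m \<le> b" using a(4) b by force
    have "f a \<in> dyadic_rationals"
    proof (rule ccontr)
      assume "f a \<notin> dyadic_rationals"
      then have "m \<le> a" unfolding m_def using a N by (intro Min_le) auto
      then show False using a by simp
    qed
    moreover have "f m = f a + (2 powi k * m - 2 powi k * a)"
      using e a(3) b mb by (simp add: algebra_simps)
    ultimately show False
      using m C(2) a(1) by (metis dyadic_add dyadic_diff dyadic_mult_powi subsetD)
  qed
  have "\<exists>q. \<forall>a\<in>C. a < 1 \<longrightarrow> (\<exists>b\<in>C. a < b \<and> {a<..<b} \<inter> B = {} \<and>
      (\<forall>x\<in>{a..b}. f x = 2 powi (fst (q a)) * x + snd (q a)))"
    using piece by (intro bchoice) (metis fst_conv snd_conv)
  then obtain q :: "real \<Rightarrow> int \<times> real" where q: "\<And>a. a \<in> C \<Longrightarrow> a < 1 \<Longrightarrow> \<exists>b\<in>C. a < b \<and> {a<..<b} \<inter> B = {} \<and>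
      (\<forall>x\<in>{a..b}. f x = 2 powi (fst (q a)) * x + snd (q a))" by blast
  have qd: "snd (q a) \<in> dyadic_rationals" if a: "a \<in> C" "a < 1" for a
  proof -
    from q[OF a] obtain b where "a < b" "\<forall>x\<in>{a..b}. f x = 2 powi (fst (q a)) * x + snd (q a)" by blast
    then have "snd (q a) = f a - 2 powi (fst (q a)) * a" by simp
    then show ?thesis using dy[OF a(1)] a C(2) by (metis dyadic_diff dyadic_mult_powi subsetD)
  qed
  show ?thesis
  proof (intro exI[of _ "q ` {a \<in> C. a < 1}"] conjI ballI)
    show "finite (q ` {a \<in> C. a < 1})" using C(1) by simp
    show "snd ` q ` {a \<in> C. a < 1} \<subseteq> dyadic_rationals" using qd by auto
    fix x :: real assume x: "x \<in> {0..1}"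
    show "\<exists>(k, c)\<in>q ` {a \<in> C. a < 1}. f x = 2 powi k * x + c"
    proof (cases "x = 0")
      case True
      have "0 \<in> {a \<in> C. a < 1}" using C by auto
      moreover from q[of 0] C obtain b where "0 < b" "\<forall>x\<in>{0..b}. f x = 2 powi (fst (q 0)) * x + snd (q 0)" by auto
      ultimately show ?thesis using True by (intro bexI[of _ "q 0"]) (auto simp: split_beta)
    next
      case False
      with x have "0 < x" "x \<le> 1" by auto
      from below[OF this] obtain a where a: "a \<in> C" "a < 1" "a < x" "{a<..<x} \<inter> C = {}" by blast
      from q[OF a(1,2)] obtain b where b: "b \<in> C" "a < b"
        and e: "\<forall>x\<in>{a..b}. f x = 2 powi (fst (q a)) * x + snd (q a)" by blast
      have "x \<le> b" using a(4) b by force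
      then have "f x = 2 powi (fst (q a)) * x + snd (q a)" using e a(3) by simp
      then show ?thesis using a by (intro bexI[of _ "q a"]) (auto simp: split_beta)
    qed
  qed
qed

lemma thompson_maps_perm_dyadic_points:
  assumes f: "f \<in> thompson_maps" shows "bij_betw f dyadic_points dyadic_points"
proof -
  have b: "bij_betw f {0..1} {0..1}" using f by (auto simp: thompson_maps_def)
  obtain Q :: "(int \<times> real) set" where Q: "snd ` Q \<subseteq> dyadic_rationals"
      "\<And>x. x \<in> {0..1} \<Longrightarrow> \<exists>(k, c)\<in>Q. f x = 2 powi k * x + c"
    using thompson_maps_dyadic_pieces[OF f] by blast
  have iff: "f x \<in> dyadic_points \<longleftrightarrow> x \<in> dyadic_points" if x: "x \<in> {0..1}" for x
  proof -
    from Q(2)[OF x] obtain k c where kc: "(k, c) \<in> Q" "f x = 2 powi k * x + c" by auto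
    then have c: "c \<in> dyadic_rationals" using Q(1) by force
    have "x = 2 powi (- k) * (f x - c)"
      by (simp add: kc(2) power_int_minus)
    then have "f x \<in> dyadic_rationals \<longleftrightarrow> x \<in> dyadic_rationals"
      using kc(2) c by (metis dyadic_add dyadic_diff dyadic_mult_powi)
    moreover have "f x \<in> {0<..<1} \<longleftrightarrow> x \<in> {0<..<1}"
    proof -
      have "f x \<in> {0..1}" using b x by (auto simp: bij_betw_def)
      moreover have "f x = f 0 \<longleftrightarrow> x = 0" "f x = f 1 \<longleftrightarrow> x = 1"
        using b x by (auto simp: bij_betw_def inj_on_def)
      ultimately show ?thesis using x thompson_maps_endpoints[OF f] by (auto simp: less_le)
    qed
    ultimately show ?thesis by (auto simp: dyadic_points_def)
  qed
  have sub: "dyadic_points \<subseteq> {0..1}" by (auto simp: dyadic_points_def)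
  show ?thesis
  proof (rule bij_betw_subset[OF b sub])
    show "f ` dyadic_points = dyadic_points"
    proof
      show "f ` dyadic_points \<subseteq> dyadic_points" using iff sub by auto
      show "dyadic_points \<subseteq> f ` dyadic_points"
      proof
        fix y assume y: "y \<in> dyadic_points"
        then have "y \<in> f ` {0..1}" using sub b by (auto simp: bij_betw_def)
        then show "y \<in> f ` dyadic_points" using iff y by blast
      qed
    qed
  qed
qed

section \<open>An almost invariant set of dyadic points\<close>

text \<open>
  Reduced numerators congruent to \<open>1\<close>, rather than \<open>3\<close>, modulo \<open>4\<close>: equivalently, the second-to-last
  digit of the finite binary expansion is \<open>0\<close>.  The action of the group rewrites prefixes of
  binary expansions, so it changes this digit only where the expansion is short.
\<close>
definition numerator_1_mod_4 :: "real set" where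
  "numerator_1_mod_4 = {x \<in> dyadic_points. \<exists>m n :: int. x = of_int (4 * m + 1) * 2 powi n}"

lemma dyadic_odd_numerator:
  assumes "x \<in> dyadic_rationals" "x \<noteq> 0"
  obtains q n :: int where "odd q" "x = of_int q * 2 powi n"
proof -
  from assms(1) obtain a b :: int where x: "x = of_int a * 2 powi b" by (rule dyadicE)
  have "a \<noteq> 0" using assms(2) x by auto
  then obtain q where q: "a = 2 ^ multiplicity 2 a * q" "\<not> 2 dvd q"
    using multiplicity_decompose'[of a 2] by auto
  have "x = of_int q * 2 powi (int (multiplicity 2 a) + b)"
    by (subst x, subst q(1)) (simp add: power_int_add)
  then show ?thesis using q(2) that by blast
qed

lemma odd_numerator_unique:
  fixes q q' n n' :: int
  assumes "odd q" "odd q'" "of_int q * (2::real) powi n = of_int q' * 2 powi n'"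
  shows "q = q'"
proof -
  have *: "q = q'" if "odd q" "n \<le> n'" "of_int q * (2::real) powi n = of_int q' * 2 powi n'"
    for q q' n n' :: int
  proof -
    have "of_int q * (2::real) powi n = of_int (q' * 2 ^ nat (n' - n)) * 2 powi n"
      using that powi_split[of n n'] by simp
    moreover have "(2::real) powi n \<noteq> 0" by simp
    ultimately have eq: "q = q' * 2 ^ nat (n' - n)" by (metis mult_right_cancel of_int_eq_iff)
    then have "nat (n' - n) = 0" using that(1) by (cases "nat (n' - n)") auto
    then show ?thesis using eq by simp
  qed
  show ?thesis
    using *[of q n n' q'] *[of q' n' n q] assms by linarith
qed

lemma numerator_1_mod_4_iff:
  assumes "odd q" "of_int q * 2 powi n \<in> dyadic_points"
  shows "of_int q * 2 powi n \<in> numerator_1_mod_4 \<longleftrightarrow> q mod 4 = 1"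
proof
  assume "of_int q * 2 powi n \<in> numerator_1_mod_4"
  then obtain m n' :: int where "of_int q * (2::real) powi n = of_int (4 * m + 1) * 2 powi n'"
    unfolding numerator_1_mod_4_def by blast
  then have "q = 4 * m + 1" by (intro odd_numerator_unique[OF assms(1)]) auto
  then show "q mod 4 = 1" by simp
next
  assume "q mod 4 = 1"
  then have "q = 4 * (q div 4) + 1" by presburger
  then have "of_int q * (2::real) powi n = of_int (4 * (q div 4) + 1) * 2 powi n"
    by (rule arg_cong[where f = "\<lambda>z. of_int z * (2::real) powi n"])
  then show "of_int q * 2 powi n \<in> numerator_1_mod_4"
    unfolding numerator_1_mod_4_def using assms(2) by blast
qed

text \<open>
  These points are multiples of \<open>2 powi N\<close> between \<open>0\<close> and \<open>1\<close>.
\<close>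
lemma finite_coarse_points:
  "finite {x \<in> {0<..<1}. \<exists>q n :: int. N \<le> n \<and> x = of_int q * (2::real) powi n}"
proof (rule finite_subset)
  show "{x \<in> {0<..<1}. \<exists>q n :: int. N \<le> n \<and> x = of_int q * (2::real) powi n}
      \<subseteq> (\<lambda>j. of_int j * 2 powi N) ` {0..\<lceil>(2::real) powi (- N)\<rceil> :: int}"
  proof
    fix x :: real assume "x \<in> {x \<in> {0<..<1}. \<exists>q n :: int. N \<le> n \<and> x = of_int q * (2::real) powi n}"
    then obtain q n :: int where x: "0 < x" "x < 1" "N \<le> n" "x = of_int q * 2 powi n" by auto
    define j where "j = q * 2 ^ nat (n - N)"
    have xj: "x = of_int j * 2 powi N" using x powi_split[of N n] by (simp add: j_def)
    have p: "0 < of_int j * (2::real) powi N" and l: "of_int j * (2::real) powi N < 1"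
      using x(1,2) xj by auto
    have "0 < real_of_int j" by (rule zero_less_mult_pos2[OF p]) simp
    moreover have "real_of_int j < 2 powi (- N)"
      using l by (simp add: power_int_minus field_simps)
    ultimately have "j \<in> {0..\<lceil>(2::real) powi (- N)\<rceil>}" by simp linarith
    then show "x \<in> (\<lambda>j. of_int j * 2 powi N) ` {0..\<lceil>(2::real) powi (- N)\<rceil> :: int}" using xj by blast
  qed
qed simp

text \<open>
  Let \<open>x = q * 2 powi n\<close> with \<open>q\<close> odd and let the piece at \<open>x\<close> be \<open>x \<mapsto> 2 powi k * x + a * 2 powi b\<close>.
  If \<open>n + k + 2 \<le> b\<close>, the numerator of the image is \<open>q\<close> plus a multiple of \<open>4\<close>.  So every moved point
  has \<open>n > b - k - 2\<close> for one of the finitely many pieces.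
\<close>
lemma finite_moved_points:
  assumes f: "f \<in> thompson_maps"
  shows "finite (moved_points dyadic_points numerator_1_mod_4 f)"
proof -
  obtain Q :: "(int \<times> real) set" where Q: "finite Q" "snd ` Q \<subseteq> dyadic_rationals"
      "\<forall>x\<in>{0..1}. \<exists>(k, c)\<in>Q. f x = 2 powi k * x + c"
    using thompson_maps_dyadic_pieces[OF f] by (elim exE conjE)
  define P where "P = (\<lambda>(k::int, c::real). {x \<in> moved_points dyadic_points numerator_1_mod_4 f. f x = 2 powi k * x + c})"
  have "finite (P kc)" if kcQ: "kc \<in> Q" for kc
  proof -
    obtain k c where kc: "kc = (k, c)" by (cases kc)
    have "c \<in> dyadic_rationals" using kcQ kc Q(2) by force
    then obtain a b :: int where c: "c = of_int a * 2 powi b" by (rule dyadicE)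
    have "P kc \<subseteq> {x \<in> {0<..<1}. \<exists>q n :: int. b - k - 1 \<le> n \<and> x = of_int q * (2::real) powi n}"
    proof
      fix x assume "x \<in> P kc"
      then have x: "x \<in> dyadic_points" "(f x \<in> numerator_1_mod_4) \<noteq> (x \<in> numerator_1_mod_4)"
        and fx: "f x = 2 powi k * x + c" by (auto simp: P_def kc moved_points_def)
      have x01: "x \<in> {0<..<1}" "x \<in> dyadic_rationals" "x \<noteq> 0" using x(1) by (auto simp: dyadic_points_def)
      obtain q n :: int where q: "odd q" "x = of_int q * 2 powi n"
        by (rule dyadic_odd_numerator[OF x01(2,3)])
      have fD: "f x \<in> dyadic_points"
        using thompson_maps_perm_dyadic_points[OF f] x(1) by (auto simp: bij_betw_def)
      have "b - k - 1 \<le> n"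
      proof (rule ccontr)
        assume "\<not> b - k - 1 \<le> n"
        then have le: "n + k + 2 \<le> b" by linarith
        define r where "r = a * 2 ^ nat (b - (n + k + 2))"
        have four: "(2::real) powi (n + k + 2) = 4 * 2 powi (n + k)"
          by (simp add: power_int_add)
        have "c = of_int (4 * r) * 2 powi (n + k)"
          unfolding c r_def powi_split[OF le] four by simp
        moreover have "f x = 2 powi k * (of_int q * 2 powi n) + c"
          using fx by (simp only: q(2)[symmetric])
        ultimately have fx': "f x = of_int (q + 4 * r) * 2 powi (n + k)"
          by (simp add: power_int_add algebra_simps)
        have "f x \<in> numerator_1_mod_4 \<longleftrightarrow> (q + 4 * r) mod 4 = 1"
          unfolding fx' by (rule numerator_1_mod_4_iff) (use q(1) fD fx' in auto)
        moreover have "x \<in> numerator_1_mod_4 \<longleftrightarrow> q mod 4 = 1"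
          unfolding q(2) by (rule numerator_1_mod_4_iff) (use q x(1) in auto)
        ultimately show False using x(2) by simp
      qed
      then show "x \<in> {x \<in> {0<..<1}. \<exists>q n :: int. b - k - 1 \<le> n \<and> x = of_int q * (2::real) powi n}"
        using x01(1) q(2) by blast
    qed
    then show ?thesis by (rule finite_subset) (rule finite_coarse_points)
  qed
  moreover have "moved_points dyadic_points numerator_1_mod_4 f \<subseteq> (\<Union>kc\<in>Q. P kc)"
  proof
    fix x assume x: "x \<in> moved_points dyadic_points numerator_1_mod_4 f"
    then have "x \<in> {0..1}" by (auto simp: moved_points_def dyadic_points_def)
    with Q(3) obtain k c where "(k, c) \<in> Q" "f x = 2 powi k * x + c" by fast
    then show "x \<in> (\<Union>kc\<in>Q. P kc)" using x by (intro UN_I[of "(k, c)"]) (simp_all add: P_def)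
  qed
  ultimately show ?thesis using Q(1) by (meson finite_UN_I finite_subset)
qed

section \<open>Inverses and words in Thompson's group\<close>

text \<open>
  Break points of the inverse are the images of those of \<open>f\<close>.  These are dyadic because \<open>f\<close>
  preserves dyadic points.
\<close>
lemma thompson_maps_inverse:
  assumes f: "f \<in> thompson_maps"
  obtains f' where "f' \<in> thompson_maps" "f' \<circ> f = id" "f \<circ> f' = id"
proof -
  have out: "\<And>x. x \<notin> {0..1} \<Longrightarrow> f x = x" and bij: "bij_betw f {0..1} {0..1}"
    and mono: "strict_mono_on {0..1} f"
    using f unfolding thompson_maps_def by auto
  have "\<exists>B. finite B \<and> B \<subseteq> dyadic_rationals \<and>
        (\<forall>a b. 0 \<le> a \<and> a < b \<and> b \<le> 1 \<and> {a<..<b} \<inter> B = {} \<longrightarrow>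
           (\<exists>(k::int) (c::real). \<forall>x\<in>{a..b}. f x = 2 powi k * x + c))"
    using f unfolding thompson_maps_def by (elim CollectE conjE)
  then obtain B where B: "finite B" "B \<subseteq> dyadic_rationals"
    and aff: "\<forall>a b. 0 \<le> a \<and> a < b \<and> b \<le> 1 \<and> {a<..<b} \<inter> B = {} \<longrightarrow>
           (\<exists>(k::int) (c::real). \<forall>x\<in>{a..b}. f x = 2 powi k * x + c)"
    by (elim exE conjE)
  define f' where "f' = (\<lambda>y. if y \<in> {0..1} then the_inv_into {0..1} f y else y)"
  have inv_in: "f' y \<in> {0..1}" and ff': "f (f' y) = y" if "y \<in> {0..1}" for y
    using that bij the_inv_into_into[of f "{0..1}" y "{0..1}"] f_the_inv_into_f[of f "{0..1}" y]
    by (auto simp: f'_def bij_betw_def)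
  have f_in: "f x \<in> {0..1}" if "x \<in> {0..1}" for x using that bij by (auto simp: bij_betw_def)
  have f'f: "f' (f x) = x" if "x \<in> {0..1}" for x
    using that f_in[OF that] bij the_inv_into_f_f[of f "{0..1}" x] by (auto simp: f'_def bij_betw_def)
  have less: "f x < f y \<longleftrightarrow> x < y" if "x \<in> {0..1}" "y \<in> {0..1}" for x y
    using strict_mono_onD[OF mono] that by (metis less_asym' linorder_neqE_linordered_idom)
  have "f' \<in> thompson_maps"
    unfolding thompson_maps_def
  proof (intro CollectI conjI exI)
    show "\<forall>x. x \<notin> {0..1} \<longrightarrow> f' x = x" unfolding f'_def by simp
    show "bij_betw f' {0..1} {0..1}"
      by (rule bij_betw_byWitness[where f' = f]) (use ff' f'f inv_in f_in in auto)
    show "strict_mono_on {0..1} f'"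
    proof (rule strict_mono_onI)
      fix r s :: real assume rs: "r \<in> {0..1}" "s \<in> {0..1}" "r < s"
      then show "f' r < f' s" using less[OF inv_in[OF rs(1)] inv_in[OF rs(2)]] ff' by simp
    qed
    show "finite (f ` (B \<inter> {0..1}))" using B by simp
    show "f ` (B \<inter> {0..1}) \<subseteq> dyadic_rationals"
    proof
      fix y assume "y \<in> f ` (B \<inter> {0..1})"
      then obtain x where x: "x \<in> B" "x \<in> {0..1}" "y = f x" by auto
      then have "x = 0 \<or> x = 1 \<or> x \<in> dyadic_points" using B(2) by (auto simp: dyadic_points_def)
      then show "y \<in> dyadic_rationals"
        using x(3) thompson_maps_endpoints[OF f] dyadic_0 dyadic_1 thompson_maps_perm_dyadic_points[OF f]
        by (auto simp: bij_betw_def dyadic_points_def)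
    qed
    show "\<forall>a b. 0 \<le> a \<and> a < b \<and> b \<le> 1 \<and> {a<..<b} \<inter> f ` (B \<inter> {0..1}) = {} \<longrightarrow>
           (\<exists>(k::int) (c::real). \<forall>x\<in>{a..b}. f' x = 2 powi k * x + c)"
    proof (intro allI impI)
      fix a b :: real assume ab: "0 \<le> a \<and> a < b \<and> b \<le> 1 \<and> {a<..<b} \<inter> f ` (B \<inter> {0..1}) = {}"
      then have a: "a \<in> {0..1}" and b: "b \<in> {0..1}" by auto
      have lt: "f' a < f' b" using less[OF inv_in[OF a] inv_in[OF b]] ff' a b ab by simp
      have "{f' a<..<f' b} \<inter> B = {}"
      proof (rule ccontr)
        assume "{f' a<..<f' b} \<inter> B \<noteq> {}"
        then obtain z where z: "f' a < z" "z < f' b" "z \<in> B" by auto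
        have z01: "z \<in> {0..1}" using z inv_in[OF a] inv_in[OF b] by auto
        have "a < f z" "f z < b"
          using less[OF inv_in[OF a] z01] less[OF z01 inv_in[OF b]] z ff' a b by auto
        then show False using ab z(3) z01 by auto
      qed
      then obtain k :: int and c :: real where e: "\<forall>x\<in>{f' a..f' b}. f x = 2 powi k * x + c"
        using aff[rule_format, of "f' a" "f' b"] lt inv_in[OF a] inv_in[OF b] by auto
      have "f' y = 2 powi (- k) * y + (- (2 powi (- k) * c))" if y: "y \<in> {a..b}" for y
      proof -
        have y01: "y \<in> {0..1}" using y a b by auto
        have "f' a \<le> f' y" "f' y \<le> f' b"
          using less[OF inv_in[OF y01] inv_in[OF a]] less[OF inv_in[OF b] inv_in[OF y01]] ff' y a b y01
          by (auto simp: not_less[symmetric])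
        then have "y = 2 powi k * f' y + c" using e ff'[OF y01] by simp
        then have "2 powi (- k) * y = 2 powi (- k) * (2 powi k * f' y + c)" by simp
        also have "\<dots> = f' y + 2 powi (- k) * c"
          by (simp add: power_int_minus algebra_simps)
        finally show ?thesis by simp
      qed
      then show "\<exists>(k::int) (c::real). \<forall>x\<in>{a..b}. f' x = 2 powi k * x + c" by blast
    qed
  qed
  moreover have "f' \<circ> f = id"
  proof
    fix x show "(f' \<circ> f) x = id x"
      by (cases "x \<in> {0..1}") (use f'f out in \<open>auto simp: f'_def\<close>)
  qed
  moreover have "f \<circ> f' = id"
  proof
    fix x show "(f \<circ> f') x = id x"
      by (cases "x \<in> {0..1}") (use ff' out in \<open>auto simp: f'_def\<close>)
  qed
  ultimately show ?thesis by (rule that)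
qed

lemma thompson_F_simps [simp]:
  "carrier thompson_F = thompson_maps" "mult thompson_F g h = h \<circ> g" "one thompson_F = id"
  by (simp_all add: thompson_F_def)

lemma thompson_F_m_inv:
  assumes f: "f \<in> thompson_maps" shows "m_inv thompson_F f \<in> thompson_maps"
proof -
  obtain f' where f': "f' \<in> thompson_maps" "f' \<circ> f = id" "f \<circ> f' = id"
    by (rule thompson_maps_inverse[OF f])
  have "m_inv thompson_F f = f'"
    unfolding m_inv_def
  proof (rule the_equality)
    fix y assume "y \<in> carrier thompson_F \<and> f \<otimes>\<^bsub>thompson_F\<^esub> y = \<one>\<^bsub>thompson_F\<^esub> \<and> y \<otimes>\<^bsub>thompson_F\<^esub> f = \<one>\<^bsub>thompson_F\<^esub>"
    then have "y \<circ> f = id" by simp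
    then have "y \<circ> (f \<circ> f') = f'" by (metis comp_assoc id_comp)
    then show "y = f'" using f'(3) by simp
  qed (use f' in simp)
  then show ?thesis using f'(1) by simp
qed

definition word_product :: "(real \<Rightarrow> real) list \<Rightarrow> real \<Rightarrow> real" where
  "word_product ws = foldr (mult thompson_F) ws id"

lemma word_product_Nil: "word_product [] = id"
  by (simp add: word_product_def)

lemma word_product_Cons: "word_product (s # ws) = word_product ws \<circ> s"
  by (simp add: word_product_def)

lemma word_product_append: "word_product (us @ vs) = word_product vs \<circ> word_product us"
  by (induction us) (simp_all add: word_product_Nil word_product_Cons comp_assoc)

lemma generate_word:
  assumes "g \<in> generate thompson_F S"
  shows "\<exists>ws. set ws \<subseteq> S \<union> m_inv thompson_F ` S \<and> word_product ws = g"
  using assms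
proof (induction rule: generate.induct)
  case one
  then show ?case by (intro exI[of _ "[]"]) (simp add: word_product_Nil)
next
  case (incl h)
  then show ?case by (intro exI[of _ "[h]"]) (simp add: word_product_Nil word_product_Cons)
next
  case (inv h)
  then show ?case by (intro exI[of _ "[m_inv thompson_F h]"]) (simp add: word_product_Nil word_product_Cons)
next
  case (eng g h)
  then obtain us vs where uv: "set us \<subseteq> S \<union> m_inv thompson_F ` S" "word_product us = g"
      "set vs \<subseteq> S \<union> m_inv thompson_F ` S" "word_product vs = h" by blast
  then have "word_product (us @ vs) = g \<otimes>\<^bsub>thompson_F\<^esub> h"
    by (simp only: word_product_append thompson_F_simps(2))
  then show ?case using uv by (intro exI[of _ "us @ vs"] conjI) auto
qed

text \<open>
  By \<open>moved_points_comp\<close> the number of moved points is subadditive, so the maximum over the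
  generators and their inverses is a Lipschitz constant with respect to the word length.
\<close>
lemma card_moved_points_word_length:
  assumes S: "finite_generating_set thompson_F S"
  obtains C where "\<And>g. g \<in> thompson_maps \<Longrightarrow>
    card (moved_points dyadic_points numerator_1_mod_4 g) \<le> C * word_length thompson_F S g"
proof -
  let ?c = "\<lambda>g. card (moved_points dyadic_points numerator_1_mod_4 g)"
  let ?S = "S \<union> m_inv thompson_F ` S"
  have finS: "finite ?S" and S_in: "?S \<subseteq> thompson_maps"
    using S thompson_F_m_inv by (auto simp: finite_generating_set_def)
  define C where "C = Max (insert 0 (?c ` ?S))"
  have C: "?c s \<le> C" if "s \<in> ?S" for s
    unfolding C_def using finS that by (intro Max_ge) auto
  have words: "bij_betw (word_product ws) dyadic_points dyadic_points
      \<and> finite (moved_points dyadic_points numerator_1_mod_4 (word_product ws))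
      \<and> ?c (word_product ws) \<le> C * length ws" if "set ws \<subseteq> ?S" for ws
    using that
  proof (induction ws)
    case Nil
    then show ?case by (auto simp: moved_points_def bij_betw_def word_product_Nil)
  next
    case (Cons s ws)
    let ?h = "word_product ws"
    have s: "s \<in> ?S" "s \<in> thompson_maps" using Cons.prems S_in by auto
    have b: "bij_betw s dyadic_points dyadic_points" by (rule thompson_maps_perm_dyadic_points[OF s(2)])
    have IH: "bij_betw ?h dyadic_points dyadic_points"
      "finite (moved_points dyadic_points numerator_1_mod_4 ?h)" "?c ?h \<le> C * length ws"
      using Cons by auto
    have "?c (?h \<circ> s) \<le> C * length (s # ws)"
      using moved_points_comp(2)[OF b finite_moved_points[OF s(2)] IH(2)] C[OF s(1)] IH(3) by simp
    then show ?case unfolding word_product_Cons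
      using bij_betw_trans[OF b IH(1)] moved_points_comp(1)[OF b finite_moved_points[OF s(2)] IH(2)]
      by blast
  qed
  have "?c g \<le> C * word_length thompson_F S g" if g: "g \<in> thompson_maps" for g
  proof -
    have "g \<in> generate thompson_F S" using S g by (simp add: finite_generating_set_def)
    from generate_word[OF this]
    have "\<exists>n ws. length ws = n \<and> set ws \<subseteq> ?S \<and> foldr (mult thompson_F) ws \<one>\<^bsub>thompson_F\<^esub> = g"
      unfolding word_product_def thompson_F_simps(3) by blast
    from LeastI_ex[OF this] obtain ws where "length ws = word_length thompson_F S g" "set ws \<subseteq> ?S"
      "word_product ws = g"
      unfolding word_length_def word_product_def thompson_F_simps(3) by blast
    then show ?thesis using words[of ws] by auto
  qed
  then show ?thesis by (rule that)
qed

section \<open>A pair of contractions with disjoint images\<close>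

text \<open>
  Both maps halve \<open>[1/4, 3/4]\<close>, moving it onto \<open>[1/4, 1/2]\<close> and onto \<open>[1/2, 3/4]\<close>; the slope \<open>2\<close> on
  one of the outer quarters makes up for the lost length.
\<close>
definition shrink_left :: "real \<Rightarrow> real" where
  "shrink_left x = (if 1/4 \<le> x \<and> x \<le> 3/4 then x / 2 + 1/8 else if 3/4 \<le> x \<and> x \<le> 1 then 2 * x - 1 else x)"

definition shrink_right :: "real \<Rightarrow> real" where
  "shrink_right x = (if 1/4 \<le> x \<and> x \<le> 3/4 then x / 2 + 3/8 else if 0 \<le> x \<and> x \<le> 1/4 then 2 * x else x)"

lemma thompson_mapsI_quarters:
  assumes out: "\<And>x. x \<notin> {0..1} \<Longrightarrow> f x = x"
    and bij: "bij_betw f {0..1} {0..1}" and mono: "strict_mono_on {0..1} f"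
    and "\<And>x. 0 \<le> x \<Longrightarrow> x \<le> 1/4 \<Longrightarrow> f x = 2 powi k1 * x + c1"
    and "\<And>x. 1/4 \<le> x \<Longrightarrow> x \<le> 3/4 \<Longrightarrow> f x = 2 powi k2 * x + c2"
    and "\<And>x. 3/4 \<le> x \<Longrightarrow> x \<le> 1 \<Longrightarrow> f x = 2 powi k3 * x + c3"
  shows "f \<in> thompson_maps"
  unfolding thompson_maps_def
proof (intro CollectI conjI exI[of _ "{1/4, 3/4}"] allI impI)
  have "1/4 = of_int 1 * (2::real) powi (-2)" "3/4 = of_int 3 * (2::real) powi (-2)"
    by (simp_all add: power_int_minus)
  then show "{1/4, 3/4} \<subseteq> dyadic_rationals"
    by (metis dyadic_of_int_powi insert_subset empty_subsetI)
  fix a b :: real assume ab: "0 \<le> a \<and> a < b \<and> b \<le> 1 \<and> {a<..<b} \<inter> {1/4, 3/4} = {}"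
  then have "b \<le> 1/4 \<or> 1/4 \<le> a \<and> b \<le> 3/4 \<or> 3/4 \<le> a" by auto
  then show "\<exists>(k::int) (c::real). \<forall>x\<in>{a..b}. f x = 2 powi k * x + c"
  proof (elim disjE)
    assume "b \<le> 1/4"
    then show ?thesis using assms(4) ab by (intro exI[of _ k1] exI[of _ c1]) auto
  next
    assume "1/4 \<le> a \<and> b \<le> 3/4"
    then show ?thesis using assms(5) ab by (intro exI[of _ k2] exI[of _ c2]) auto
  next
    assume "3/4 \<le> a"
    then show ?thesis using assms(6) ab by (intro exI[of _ k3] exI[of _ c3]) auto
  qed
qed (use out bij mono in auto)

lemma shrink_left_thompson: "shrink_left \<in> thompson_maps"
proof (rule thompson_mapsI_quarters[where ?k1.0=0 and ?c1.0=0 and ?k2.0="-1" and ?c2.0="1/8" and ?k3.0=1 and ?c3.0="-1"])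
  show "bij_betw shrink_left {0..1} {0..1}"
    by (rule bij_betw_byWitness[where f' =
        "\<lambda>y. if y < 1/4 then y else if y \<le> 1/2 then 2 * y - 1/4 else (y + 1) / 2"])
      (auto simp: shrink_left_def field_simps)
qed (auto simp: shrink_left_def strict_mono_on_def power_int_minus)

lemma shrink_right_thompson: "shrink_right \<in> thompson_maps"
proof (rule thompson_mapsI_quarters[where ?k1.0=1 and ?c1.0=0 and ?k2.0="-1" and ?c2.0="3/8" and ?k3.0=0 and ?c3.0="0"])
  show "bij_betw shrink_right {0..1} {0..1}"
    by (rule bij_betw_byWitness[where f' =
        "\<lambda>y. if y < 1/2 then y / 2 else if y \<le> 3/4 then 2 * y - 3/4 else y"])
      (auto simp: shrink_right_def field_simps)
qed (auto simp: shrink_right_def strict_mono_on_def power_int_minus)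

text \<open>
  The interval is half-open to make the two images disjoint.
\<close>
definition middle_points :: "real set" where
  "middle_points = dyadic_points \<inter> {1/4..<3/4}"

lemma shrink_middle_points:
  "shrink_left ` middle_points \<subseteq> middle_points" "shrink_right ` middle_points \<subseteq> middle_points"
  "shrink_left ` middle_points \<inter> shrink_right ` middle_points = {}"
proof -
  have "shrink_left x \<in> dyadic_points" "shrink_right x \<in> dyadic_points" if "x \<in> dyadic_points" for x
    using thompson_maps_perm_dyadic_points[OF shrink_left_thompson]
      thompson_maps_perm_dyadic_points[OF shrink_right_thompson] that by (auto simp: bij_betw_def)
  moreover have "shrink_left x \<in> {1/4..<1/2}" "shrink_right x \<in> {1/2..<3/4}" if "x \<in> {1/4..<3/4}" for x
    using that by (auto simp: shrink_left_def shrink_right_def)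
  ultimately have "shrink_left ` middle_points \<subseteq> dyadic_points \<inter> {1/4..<1/2}"
    "shrink_right ` middle_points \<subseteq> dyadic_points \<inter> {1/2..<3/4}"
    unfolding middle_points_def by blast+
  moreover have "{1/4..<1/2::real} \<inter> {1/2..<3/4} = {}"
    "{1/4..<1/2::real} \<subseteq> {1/4..<3/4}" "{1/2..<3/4::real} \<subseteq> {1/4..<3/4}" by auto
  ultimately show "shrink_left ` middle_points \<subseteq> middle_points" "shrink_right ` middle_points \<subseteq> middle_points"
    "shrink_left ` middle_points \<inter> shrink_right ` middle_points = {}"
    unfolding middle_points_def by blast+
qed

text \<open>
  Points of both classes close to \<open>1/2\<close>: the numerator \<open>2 ^ (n + 2) + e\<close> is congruent to \<open>e\<close>
  modulo \<open>4\<close>.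
\<close>
lemma near_half:
  fixes e :: int and n :: nat
  assumes e: "e = 1 \<or> e = -1"
  defines "x \<equiv> 1/2 + of_int e / (2::real) ^ (n + 3)"
  shows "x \<in> middle_points" "x \<in> numerator_1_mod_4 \<longleftrightarrow> e = 1"
proof -
  define q where "q = 2 ^ (n + 2) + e"
  have xq: "x = of_int q * 2 powi (- int (n + 3))"
  proof -
    have "(2::real) powi (- int (n + 3)) = 1 / 2 ^ (n + 3)"
      by (simp only: power_int_minus power_int_of_nat inverse_eq_divide)
    then show ?thesis by (simp only:) (simp add: x_def q_def field_simps power_add)
  qed
  have le: "(1::real) / 2 ^ (n + 3) \<le> 1 / 8" 
    by (simp add: power_add field_simps)
  have "0 < (1::real) / 2 ^ (n + 3)" by simp
  then have b: "3/8 \<le> x" "x \<le> 5/8" using e le by (auto simp: x_def)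
  have D: "x \<in> dyadic_points" using b xq by (auto simp: dyadic_points_def)
  then show "x \<in> middle_points" using b by (simp add: middle_points_def)
  have odd: "odd q" using e by (auto simp: q_def)
  have "q mod 4 = e mod 4" by (simp add: q_def power_add)
  then show "x \<in> numerator_1_mod_4 \<longleftrightarrow> e = 1"
    using numerator_1_mod_4_iff[OF odd, of "- int (n + 3)"] D e unfolding xq by auto
qed

lemma inj_near_half: "c \<noteq> 0 \<Longrightarrow> inj (\<lambda>n::nat. 1/2 + c / (2::real) ^ (n + 3))"
  by (rule injI) (simp add: power_add)

lemma infinite_middle_points:
  "infinite (middle_points \<inter> numerator_1_mod_4)" "infinite (middle_points - numerator_1_mod_4)"
proof -
  have "range (\<lambda>n::nat. 1/2 + of_int 1 / (2::real) ^ (n + 3)) \<subseteq> middle_points \<inter> numerator_1_mod_4"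
    using near_half[of 1] by blast
  moreover have "infinite (range (\<lambda>n::nat. 1/2 + of_int 1 / (2::real) ^ (n + 3)))"
    by (rule range_inj_infinite, rule inj_near_half) simp
  ultimately show "infinite (middle_points \<inter> numerator_1_mod_4)" by (rule infinite_super)
  have "range (\<lambda>n::nat. 1/2 + of_int (-1) / (2::real) ^ (n + 3)) \<subseteq> middle_points - numerator_1_mod_4"
    using near_half[of "-1"] by fastforce
  moreover have "infinite (range (\<lambda>n::nat. 1/2 + of_int (-1) / (2::real) ^ (n + 3)))"
    by (rule range_inj_infinite, rule inj_near_half) simp
  ultimately show "infinite (middle_points - numerator_1_mod_4)" by (rule infinite_super)
qed

section \<open>The induced walk on dyadic points\<close>

lemma integrable_pmf_iff_summable:
  "integrable (measure_pmf p) F \<longleftrightarrow> (\<lambda>x. norm (pmf p x * F x)) summable_on UNIV" for F :: "'a \<Rightarrow> real"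
proof -
  have "integrable (measure_pmf p) F \<longleftrightarrow> integrable (count_space UNIV) (\<lambda>x. pmf p x *\<^sub>R F x)"
    unfolding measure_pmf_eq_density by (rule integrable_density) auto
  also have "\<dots> \<longleftrightarrow> Infinite_Set_Sum.abs_summable_on (\<lambda>x. pmf p x * F x) UNIV"
    by (simp add: Infinite_Set_Sum.abs_summable_on_def)
  also have "\<dots> \<longleftrightarrow> (\<lambda>x. norm (pmf p x * F x)) summable_on UNIV"
    by (rule abs_summable_equivalent[symmetric])
  finally show ?thesis .
qed

lemma pmf_expectation_infsum:
  fixes F :: "'a \<Rightarrow> real"
  assumes "integrable (measure_pmf p) F" "set_pmf p \<subseteq> A"
  shows "measure_pmf.expectation p F = (\<Sum>\<^sub>\<infinity>x\<in>A. pmf p x * F x)"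
proof -
  have "Infinite_Set_Sum.abs_summable_on (\<lambda>x. pmf p x * F x) UNIV"
    using assms(1) unfolding integrable_pmf_iff_summable abs_summable_equivalent .
  then have "measure_pmf.expectation p F = (\<Sum>\<^sub>\<infinity>x. pmf p x * F x)"
    unfolding pmf_expectation_eq_infsetsum by (rule infsetsum_infsum)
  also have "\<dots> = (\<Sum>\<^sub>\<infinity>x\<in>A. pmf p x * F x)"
    by (rule infsum_cong_neutral) (use assms(2) in \<open>auto simp: set_pmf_iff subset_iff\<close>)
  finally show ?thesis .
qed

lemma integrable_card_moved_points:
  assumes supp: "set_pmf \<mu> \<subseteq> carrier thompson_F"
    and S: "finite_generating_set thompson_F S" and mom: "finite_first_moment thompson_F S \<mu>"
  shows "integrable (measure_pmf \<mu>) (\<lambda>g. real (card (moved_points dyadic_points numerator_1_mod_4 g)))"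
proof -
  obtain C where C: "\<And>g. g \<in> thompson_maps \<Longrightarrow>
    card (moved_points dyadic_points numerator_1_mod_4 g) \<le> C * word_length thompson_F S g"
    by (rule card_moved_points_word_length[OF S]) blast
  have "(\<lambda>g. norm (pmf \<mu> g * real (word_length thompson_F S g))) summable_on UNIV"
    using mom unfolding finite_first_moment_def
    by (rule summable_on_cong_neutral[THEN iffD1, rotated 3])
       (use supp in \<open>auto simp: mult.commute set_pmf_iff subset_iff\<close>)
  then have "integrable (measure_pmf \<mu>) (\<lambda>g. real (word_length thompson_F S g))"
    unfolding integrable_pmf_iff_summable .
  then have "integrable (measure_pmf \<mu>) (\<lambda>g. real C * real (word_length thompson_F S g))" by simp
  then show ?thesis
  proof (rule Bochner_Integration.integrable_bound)
    show "AE g in measure_pmf \<mu>. norm (real (card (moved_points dyadic_points numerator_1_mod_4 g)))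
        \<le> norm (real C * real (word_length thompson_F S g))"
      unfolding AE_measure_pmf_iff
    proof
      fix g assume "g \<in> set_pmf \<mu>"
      then have "g \<in> thompson_maps" using supp by auto
      from C[OF this] show "norm (real (card (moved_points dyadic_points numerator_1_mod_4 g)))
        \<le> norm (real C * real (word_length thompson_F S g))"
        by (simp flip: of_nat_mult)
    qed
  qed simp
qed

lemma induced_walk_kernel_pmf:
  assumes supp: "set_pmf \<mu> \<subseteq> carrier thompson_F"
  shows "induced_walk_kernel \<mu> x y = pmf (map_pmf (\<lambda>g. g x) \<mu>) y"
proof -
  have "induced_walk_kernel \<mu> x y = measure_pmf.prob \<mu> {g \<in> carrier thompson_F. g x = y}"
    unfolding induced_walk_kernel_def measure_pmf_conv_infsetsum
    by (rule infsetsum_infsum[symmetric]) (rule pmf_abs_summable)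
  also have "\<dots> = measure_pmf.prob \<mu> ((\<lambda>g. g x) -` {y})"
    by (rule measure_pmf.finite_measure_eq_AE) (use supp in \<open>auto simp: AE_measure_pmf_iff\<close>)
  finally show ?thesis by (simp add: pmf_map)
qed

theorem corollary1p3:
  fixes \<mu> :: "(real \<Rightarrow> real) pmf" and S :: "(real \<Rightarrow> real) set"
  assumes "set_pmf \<mu> \<subseteq> carrier thompson_F"
    and "finite_generating_set thompson_F S"
    and "finite_first_moment thompson_F S \<mu>"
    and "semigroup_generate thompson_F (set_pmf \<mu>) = carrier thompson_F"
  shows "nontrivial_poisson_boundary dyadic_points (induced_walk_kernel \<mu>)"
proof -
  interpret permutation_walk dyadic_points \<mu>
  proof
    show "countable dyadic_points" by (rule countable_dyadic_points)
    show "bij_betw g dyadic_points dyadic_points" if "g \<in> set_pmf \<mu>" for g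
      using that assms(1) by (intro thompson_maps_perm_dyadic_points) auto
  qed
  have controlled: "energy_controlled g" if "g \<in> thompson_maps" for g
  proof -
    have "g \<in> semigroup_generate thompson_F (set_pmf \<mu>)" using that assms(4) by simp
    then show ?thesis
    proof (induction rule: semigroup_generate.induct)
      case (incl g)
      then show ?case by (rule energy_controlled_step)
    next
      case (mult g h)
      then show ?case unfolding thompson_F_simps(2) by (intro energy_controlled_comp)
    qed
  qed
  obtain f where f01: "\<And>x. x \<in> dyadic_points \<Longrightarrow> f x \<in> {0..1}"
    and harm: "\<And>x. x \<in> dyadic_points \<Longrightarrow> markov f x = f x"
    and nonconst: "\<not> f constant_on dyadic_points"
  proof (rule nonconstant_harmonic)
    show "finite (moved_points dyadic_points numerator_1_mod_4 g)" if "g \<in> set_pmf \<mu>" for g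
      using that assms(1) by (intro finite_moved_points) auto
    show "integrable (measure_pmf \<mu>) (\<lambda>g. real (card (moved_points dyadic_points numerator_1_mod_4 g)))"
      by (rule integrable_card_moved_points[OF assms(1-3)])
    show "energy_controlled shrink_left" "energy_controlled shrink_right"
      by (intro controlled shrink_left_thompson shrink_right_thompson)+
    show "middle_points \<subseteq> dyadic_points" by (auto simp: middle_points_def)
    show "shrink_left ` middle_points \<subseteq> middle_points" "shrink_right ` middle_points \<subseteq> middle_points"
      "shrink_left ` middle_points \<inter> shrink_right ` middle_points = {}"
      by (fact shrink_middle_points)+
    show "infinite (middle_points \<inter> numerator_1_mod_4)" "infinite (middle_points - numerator_1_mod_4)"
      by (fact infinite_middle_points)+
  qed blast
  have "harmonic_on dyadic_points (induced_walk_kernel \<mu>) f"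
    unfolding harmonic_on_def
  proof
    fix x assume x: "x \<in> dyadic_points"
    let ?\<nu> = "map_pmf (\<lambda>g. g x) \<mu>"
    have supp: "set_pmf ?\<nu> \<subseteq> dyadic_points" using perm_in[OF _ x] by auto
    have "integrable (measure_pmf ?\<nu>) f"
      by (rule measure_pmf.integrable_const_bound[where B = 1])
         (use supp f01 in \<open>force simp: AE_measure_pmf_iff\<close>)+
    from pmf_expectation_infsum[OF this supp]
    have "markov f x = (\<Sum>\<^sub>\<infinity>y\<in>dyadic_points. pmf ?\<nu> y * f y)" by (simp add: markov_def)
    then show "f x = (\<Sum>\<^sub>\<infinity>y\<in>dyadic_points. induced_walk_kernel \<mu> x y * f y)"
      using harm[OF x] by (simp add: induced_walk_kernel_pmf[OF assms(1)])
  qed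
  moreover have "bounded (f ` dyadic_points)"
    by (rule bounded_subset[of "{0..1}"]) (use f01 in auto)
  ultimately show ?thesis
    using nonconst unfolding nontrivial_poisson_boundary_def by blast
qed

end
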